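(* Let $\mathcal M$ be a von Neumann algebra with a normal faithful finite trace $\tau$, let $(T_t)_{t\ge 0}$ be a quantum Markov semigroup on $\mathcal M$, and let $\mathcal P=(P_t)_{t\ge0}$ be its subordinated Poisson semigroup. Let $\alpha_0$ be the real number satisfying $2^{\alpha_0-2}+3^{\alpha_0-3}=1$ and let $0<\alpha<\alpha_0$. Then for every integer $k\ge[\alpha]+1$ the space $\mathcal L^c_\alpha(\mathcal P)$ coincides with $\mathcal L^c_{\alpha,k}(\mathcal P)$, with equivalent norms.
   Context: Notation: $\|\cdot\|_\infty$ is the operator norm of $\mathcal M$, $|x|^2=x^*x$, $I$ is the identity operator, and $[\alpha]$ is the integer part of $\alpha$. A (quantum) Markov semigroup on $(\mathcal M,\tau)$ is a family $(T_t)_{t\ge0}$ of operators on $\mathcal M$ with $T_tT_s=T_{t+s}$, $T_0=\mathrm{id}$, such that every $T_t$ is normal, completely positive and unital ($T_t(1)=1$); $\tau(T_t(f^* )g)=\tau(f^*T_t(g))$ for all $f,g\in\mathcal M\cap L^2(\mathcal M)$; and $T_t(f)\to f$ in the weak-$*$ topology as $t\to0^+$ for all $f\in\mathcal M$. With $A$ its generator ($T_t=e^{-tA}$), the subordinated Poisson semigroup is $P_t=e^{-t\sqrt A}$, i.e. $P_0=\mathrm{id}$ and $P_t=\frac{1}{2\sqrt\pi}\int_0^\infty t e^{-t^2/(4u)}u^{-3/2}T_u\,du$ for $t>0$. For $\alpha>0$ and an integer $k\ge[\alpha]+1$: $\|f\|_{\mathcal L^c_{\alpha,k}(\mathcal P)}=\|f\|_\infty+\sup_{t>0}\frac1{t^\alpha}\big\|P_t|(I-P_t)^kf|^2\big\|_\infty^{1/2}$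 for $f\in\mathcal M$, and $\mathcal L^c_{\alpha,k}(\mathcal P)$ is the set of $f\in\mathcal M$ for which this is finite. The space $\mathcal L^c_\alpha(\mathcal P)$ and its norm are the case $k=[\alpha]+1$. *)

theory Defs
  imports "HOL-Analysis.Analysis"
begin

section \<open>Complex Hilbert spaces and their bounded operators\<close>

text \<open>
  The real structure inherited from \<^class>\<open>real_inner\<close> is the one underlying the complex
  structure, so norm and completeness are those of the complex Hilbert space.  The inner product
  is conjugate linear in its first argument.
\<close>

class chilbert_space = real_inner + complete_space +
  fixes scaleC :: "complex \<Rightarrow> 'a \<Rightarrow> 'a" (infixr "*\<^sub>C" 75)
    and cinner :: "'a \<Rightarrow> 'a \<Rightarrow> complex"
  assumes scaleC_add_right: "c *\<^sub>C (x + y) = c *\<^sub>C x + c *\<^sub>C y"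
    and scaleC_add_left: "(c + d) *\<^sub>C x = c *\<^sub>C x + d *\<^sub>C x"
    and scaleC_scaleC: "c *\<^sub>C (d *\<^sub>C x) = (c * d) *\<^sub>C x"
    and scaleR_scaleC: "r *\<^sub>R x = complex_of_real r *\<^sub>C x"
    and cinner_commute: "cinner x y = cnj (cinner y x)"
    and cinner_add_right: "cinner x (y + z) = cinner x y + cinner x z"
    and cinner_scaleC_right: "cinner x (c *\<^sub>C y) = c * cinner x y"
    and inner_eq_Re_cinner: "inner x y = Re (cinner x y)"

lemma cinner_self: "cinner x x = complex_of_real ((norm x)\<^sup>2)"
  for x :: "'h::chilbert_space"
proof (rule complex_eqI)
  show "Re (cinner x x) = Re (complex_of_real ((norm x)\<^sup>2))"
    by (simp add: inner_eq_Re_cinner[symmetric] power2_norm_eq_inner)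
  have "Im (cinner x x) = - Im (cinner x x)"
    by (metis cinner_commute cnj.simps(2))
  then show "Im (cinner x x) = Im (complex_of_real ((norm x)\<^sup>2))"
    by simp
qed

lemma norm_scaleC: "norm (c *\<^sub>C x) = cmod c * norm x" for x :: "'h::chilbert_space"
proof -
  have "cinner (c *\<^sub>C x) (c *\<^sub>C x) = c * cnj c * cinner x x"
    by (metis (no_types) cinner_commute cinner_scaleC_right complex_cnj_cnj complex_cnj_mult
        mult.assoc mult.commute)
  then have "complex_of_real ((norm (c *\<^sub>C x))\<^sup>2) = complex_of_real ((cmod c * norm x)\<^sup>2)"
    by (simp add: cinner_self complex_norm_square[symmetric] power_mult_distrib)
  then have "(norm (c *\<^sub>C x))\<^sup>2 = (cmod c * norm x)\<^sup>2"
    by (simp only: of_real_eq_iff)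
  then show ?thesis
    by (simp add: power2_eq_iff_nonneg)
qed

type_synonym 'h op = "'h \<Rightarrow>\<^sub>L 'h"

text \<open>The type \<^typ>\<open>'h op\<close> contains all bounded real-linear maps; $B(H)$ is a subset of it.\<close>

definition bounded_ops :: "'h::chilbert_space op set" where
  "bounded_ops = {a. \<forall>c x. blinfun_apply a (c *\<^sub>C x) = c *\<^sub>C blinfun_apply a x}"

lift_definition op_scaleC :: "complex \<Rightarrow> 'h::chilbert_space op \<Rightarrow> 'h op"
  is "\<lambda>c a x. c *\<^sub>C a x"
proof -
  fix c and a :: "'h \<Rightarrow> 'h"
  assume a: "bounded_linear a"
  have "bounded_linear (\<lambda>x :: 'h. c *\<^sub>C x)"
    by (rule bounded_linear_intro[where K = "cmod c"])
      (simp_all add: scaleC_add_right scaleR_scaleC scaleC_scaleC norm_scaleC mult.commute)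
  then show "bounded_linear (\<lambda>x. c *\<^sub>C a x)"
    using a by (rule bounded_linear_compose)
qed

definition adj :: "'h::chilbert_space op \<Rightarrow> 'h op" where
  "adj a = (THE b. \<forall>x y. cinner (blinfun_apply b x) y = cinner x (blinfun_apply a y))"

definition abs_sq :: "'h::chilbert_space op \<Rightarrow> 'h op" where
  "abs_sq a = adj a o\<^sub>L a"


section \<open>Von Neumann algebras and the weak-* topology\<close>

definition commutant :: "'h::chilbert_space op set \<Rightarrow> 'h op set" where
  "commutant S = {a \<in> bounded_ops. \<forall>b\<in>S. a o\<^sub>L b = b o\<^sub>L a}"

definition von_neumann_algebra :: "'h::chilbert_space op set \<Rightarrow> bool" where
  "von_neumann_algebra M \<longleftrightarrow> (\<forall>a\<in>M. adj a \<in> M) \<and> commutant (commutant M) = M"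

text \<open>
  The predual of \<open>M\<close> consists of the restrictions to \<open>M\<close> of the functionals
  $a \mapsto \sum_n \langle \xi_n, a \eta_n\rangle$ with $(\xi_n)$, $(\eta_n)$ square summable.
\<close>

definition in_predual :: "'h::chilbert_space op set \<Rightarrow> ('h op \<Rightarrow> complex) \<Rightarrow> bool" where
  "in_predual M \<phi> \<longleftrightarrow>
     (\<exists>\<xi> \<eta> :: nat \<Rightarrow> 'h.
        summable (\<lambda>n. (norm (\<xi> n))\<^sup>2) \<and> summable (\<lambda>n. (norm (\<eta> n))\<^sup>2) \<and>
        (\<forall>a\<in>M. \<phi> a = (\<Sum>n. cinner (\<xi> n) (blinfun_apply a (\<eta> n)))))"

definition weak_star :: "'h::chilbert_space op set \<Rightarrow> 'h op topology" where
  "weak_star M = topology_generated_by {{a \<in> M. \<phi> a \<in> U} |\<phi> U. in_predual M \<phi> \<and> open U}"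

text \<open>The integral $\int_S F(u)\,du \in M$ in the weak-* sense.\<close>

definition weak_star_integral ::
    "'h::chilbert_space op set \<Rightarrow> real set \<Rightarrow> (real \<Rightarrow> 'h op) \<Rightarrow> 'h op" where
  "weak_star_integral M S F =
     (THE g. g \<in> M \<and> (\<forall>\<phi>. in_predual M \<phi> \<longrightarrow>
        set_integrable lborel S (\<lambda>u. \<phi> (F u)) \<and> \<phi> g = (LINT u:S|lborel. \<phi> (F u))))"


section \<open>Traces and quantum Markov semigroups\<close>

definition normal_faithful_finite_trace ::
    "'h::chilbert_space op set \<Rightarrow> ('h op \<Rightarrow> complex) \<Rightarrow> bool" where
  "normal_faithful_finite_trace M \<tau> \<longleftrightarrow>
     (\<forall>a\<in>M. \<forall>b\<in>M. \<tau> (a + b) = \<tau> a + \<tau> b) \<and>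
     (\<forall>c. \<forall>a\<in>M. \<tau> (op_scaleC c a) = c * \<tau> a) \<and>
     (\<forall>a\<in>M. \<tau> (adj a o\<^sub>L a) \<in> \<real>\<^sub>\<ge>\<^sub>0) \<and>
     (\<forall>a\<in>M. \<forall>b\<in>M. \<tau> (a o\<^sub>L b) = \<tau> (b o\<^sub>L a)) \<and>
     (\<forall>a\<in>M. \<tau> (adj a o\<^sub>L a) = 0 \<longrightarrow> a = 0) \<and>
     continuous_map (weak_star M) euclidean \<tau>"

text \<open>Positivity of the $n \times n$ operator matrix $(a_{ij})$ as an operator on $H^n$.\<close>

definition positive_matrix :: "nat \<Rightarrow> (nat \<Rightarrow> nat \<Rightarrow> 'h::chilbert_space op) \<Rightarrow> bool" where
  "positive_matrix n a \<longleftrightarrow>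
     (\<forall>\<xi> :: nat \<Rightarrow> 'h. (\<Sum>i<n. \<Sum>j<n. cinner (\<xi> i) (blinfun_apply (a i j) (\<xi> j))) \<in> \<real>\<^sub>\<ge>\<^sub>0)"

definition completely_positive ::
    "'h::chilbert_space op set \<Rightarrow> ('h op \<Rightarrow> 'h op) \<Rightarrow> bool" where
  "completely_positive M \<Phi> \<longleftrightarrow>
     (\<forall>n a. (\<forall>i<n. \<forall>j<n. a i j \<in> M) \<and> positive_matrix n a \<longrightarrow>
        positive_matrix n (\<lambda>i j. \<Phi> (a i j)))"

text \<open>
  As \<open>\<tau>\<close> is finite, $M \cap L^2(M) = M$ in the symmetry condition.
\<close>

definition markov_semigroup ::
    "'h::chilbert_space op set \<Rightarrow> ('h op \<Rightarrow> complex) \<Rightarrow> (real \<Rightarrow> 'h op \<Rightarrow> 'h op) \<Rightarrow> bool" where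
  "markov_semigroup M \<tau> T \<longleftrightarrow>
     (\<forall>t\<ge>0. \<forall>f\<in>M. T t f \<in> M) \<and>
     (\<forall>t\<ge>0. \<forall>f\<in>M. \<forall>g\<in>M. T t (f + g) = T t f + T t g) \<and>
     (\<forall>t\<ge>0. \<forall>c. \<forall>f\<in>M. T t (op_scaleC c f) = op_scaleC c (T t f)) \<and>
     (\<forall>t\<ge>0. \<forall>s\<ge>0. \<forall>f\<in>M. T (t + s) f = T t (T s f)) \<and>
     (\<forall>f\<in>M. T 0 f = f) \<and>
     (\<forall>t\<ge>0. continuous_map (weak_star M) (weak_star M) (T t)) \<and>
     (\<forall>t\<ge>0. completely_positive M (T t)) \<and>
     (\<forall>t\<ge>0. T t id_blinfun = id_blinfun) \<and>
     (\<forall>t\<ge>0. \<forall>f\<in>M. \<forall>g\<in>M. \<tau> (T t (adj f) o\<^sub>L g) = \<tau> (adj f o\<^sub>L T t g)) \<and>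
     (\<forall>f\<in>M. limitin (weak_star M) (\<lambda>t. T t f) f (at_right 0))"

definition poisson_semigroup ::
    "'h::chilbert_space op set \<Rightarrow> (real \<Rightarrow> 'h op \<Rightarrow> 'h op) \<Rightarrow> real \<Rightarrow> 'h op \<Rightarrow> 'h op" where
  "poisson_semigroup M T t f =
     (if t = 0 then f
      else (1 / (2 * sqrt pi)) *\<^sub>R
        weak_star_integral M {0<..}
          (\<lambda>u. (t * exp (- t\<^sup>2 / (4 * u)) * u powr (- 3 / 2)) *\<^sub>R T u f))"


section \<open>The column Lipschitz spaces\<close>

definition lip_norm ::
    "(real \<Rightarrow> 'h::chilbert_space op \<Rightarrow> 'h op) \<Rightarrow> real \<Rightarrow> nat \<Rightarrow> 'h op \<Rightarrow> ennreal" where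
  "lip_norm P \<alpha> k f =
     ennreal (norm f) +
     (SUP t\<in>{0<..}. ennreal (1 / t powr \<alpha> *
        sqrt (norm (P t (abs_sq (((\<lambda>g. g - P t g) ^^ k) f))))))"

definition lip_space ::
    "'h::chilbert_space op set \<Rightarrow> (real \<Rightarrow> 'h op \<Rightarrow> 'h op) \<Rightarrow> real \<Rightarrow> nat \<Rightarrow> 'h op set" where
  "lip_space M P \<alpha> k = {f \<in> M. lip_norm P \<alpha> k f < \<infinity>}"

text \<open>The case \<open>k = [\<alpha>] + 1\<close>, for \<open>\<alpha> > 0\<close>.\<close>

definition lip_norm0 ::
    "(real \<Rightarrow> 'h::chilbert_space op \<Rightarrow> 'h op) \<Rightarrow> real \<Rightarrow> 'h op \<Rightarrow> ennreal" where
  "lip_norm0 P \<alpha> = lip_norm P \<alpha> (nat \<lfloor>\<alpha>\<rfloor> + 1)"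

definition lip_space0 ::
    "'h::chilbert_space op set \<Rightarrow> (real \<Rightarrow> 'h op \<Rightarrow> 'h op) \<Rightarrow> real \<Rightarrow> 'h op set" where
  "lip_space0 M P \<alpha> = lip_space M P \<alpha> (nat \<lfloor>\<alpha>\<rfloor> + 1)"

end

theory Submission
  imports Defs "HOL-Probability.Distributions" "HOL-Real_Asymp.Real_Asymp"
begin

text \<open>Put \<open>p\<^sub>t(g) = \<parallel>P\<^sub>t |g|\<^sup>2\<parallel>\<^sup>1\<^sup>/\<^sup>2\<close>, \<open>D\<^sub>t = I - P\<^sub>t\<close> and \<open>U\<^sub>t = (I + P\<^sub>t)/2\<close>. The theorem compares
  the growth of \<open>p\<^sub>t(D\<^sub>t\<^sup>k f)\<close> for different \<open>k\<close>, and it is enough to compare \<open>k\<close> with \<open>k + 1\<close>.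

  Each \<open>P\<^sub>t\<close> is unital, positive and satisfies the Kadison--Schwarz inequality
  \<open>|P\<^sub>t g|\<^sup>2 \<le> P\<^sub>t |g|\<^sup>2\<close>. Hence \<open>p\<^sub>t\<close> is a seminorm (\<open>column_seminorm_triangle\<close>),
  \<open>p\<^sub>s(P\<^sub>t g) \<le> p\<^sub>s\<^sub>+\<^sub>t(g) \<le> p\<^sub>s(g)\<close> (\<open>column_seminorm_P_le\<close>, \<open>column_seminorm_antimono\<close>),
  and \<open>D\<^sub>t\<close> at most doubles \<open>p\<^sub>t\<close>, so passing from \<open>k\<close> to \<open>k + 1\<close> costs a factor \<open>2\<close>.

  For the converse, \<open>g = P\<^sub>t g + D\<^sub>t g\<close> gives \<open>p\<^sub>t(g) \<le> p\<^sub>2\<^sub>t(g) + p\<^sub>t(D\<^sub>t g)\<close>: averaging once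
  more trades \<open>p\<^sub>t\<close> for \<open>p\<^sub>2\<^sub>t\<close> at the cost of one more difference. Similarly
  \<open>g - U\<^sub>t g = D\<^sub>t g / 2\<close> allows to replace \<open>g\<close> by \<open>U\<^sub>t\<^sup>k g\<close>, and the semigroup law in the form
  \<open>D\<^sub>2\<^sub>t = 2 D\<^sub>t U\<^sub>t\<close> turns \<open>U\<^sub>t\<^sup>k D\<^sub>t\<^sup>k f\<close> into \<open>2\<^sup>-\<^sup>k D\<^sub>2\<^sub>t\<^sup>k f\<close>. For \<open>a(t) = p\<^sub>t(D\<^sub>t\<^sup>k f)\<close> this yields
  (\<open>column_seminorm_doubling\<close>)
  \<open>a(t) \<le> 2\<^sup>-\<^sup>k a(2t) + (1 + k/2) p\<^sub>t(D\<^sub>t\<^sup>k\<^sup>+\<^sup>1 f)\<close>.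
  If the last term is \<open>O(t\<^sup>\<alpha>)\<close>, iterate: the coefficients form a geometric series of ratio
  \<open>2\<^sup>\<alpha>\<^sup>-\<^sup>k < 1\<close>, and the remainder \<open>2\<^sup>-\<^sup>n\<^sup>k a(2\<^sup>n t)\<close> vanishes because \<open>a \<le> 2\<^sup>k \<parallel>f\<parallel>\<close>
  (\<open>dyadic_recursion_bound\<close>).

  The rest of the work is to derive these properties of \<open>P\<^sub>t\<close> from its definition as a weak-*
  integral. The integral exists by the Riesz representation theorem applied to
  \<open>(x, y) \<mapsto> \<integral> k\<^sub>t(u) \<langle>x, T\<^sub>u f y\<rangle> du\<close>, and lies in \<open>M\<close> by the double commutant property
  (\<open>subordinated_operator_exists\<close>). The Schwarz inequality of \<open>T\<^sub>u\<close>, written as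
  \<open>2 Re \<langle>y, T\<^sub>u f x\<rangle> \<le> \<parallel>y\<parallel>\<^sup>2 + \<langle>x, T\<^sub>u |f|\<^sup>2 x\<rangle>\<close>, is linear in \<open>T\<^sub>u\<close> and can be
  integrated against the probability density \<open>k\<^sub>t\<close> (\<open>poisson_schwarz\<close>). The semigroup law
  (\<open>poisson_semigroup_law\<close>) needs the convolution identity \<open>k\<^sub>s * k\<^sub>t = k\<^sub>s\<^sub>+\<^sub>t\<close>
  (\<open>levy_convolution\<close>) and the normality of \<open>T\<^sub>u\<close>, which lets \<open>T\<^sub>u\<close> pass under the weak-*
  integral (\<open>normal_functional_poisson\<close>).\<close>

section \<open>Hilbert space operators\<close>

lemma cinner_scaleC_left: "cinner (c *\<^sub>C x) y = cnj c * cinner x y" for x y :: "'h::chilbert_space"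
  by (metis cinner_commute cinner_scaleC_right complex_cnj_mult)

lemma cinner_add_left: "cinner (x + y) z = cinner x z + cinner y z" for x y z :: "'h::chilbert_space"
  by (metis cinner_commute cinner_add_right complex_cnj_add)

lemma cinner_zero_right [simp]: "cinner x 0 = 0" for x :: "'h::chilbert_space"
  by (metis add_cancel_right_right cinner_add_right)

lemma cinner_minus_right: "cinner x (- y) = - cinner x y" for x y :: "'h::chilbert_space"
  by (metis add.inverse_unique ab_left_minus add.commute cinner_add_right cinner_zero_right)

lemma cinner_diff_right: "cinner x (y - z) = cinner x y - cinner x z" for x y z :: "'h::chilbert_space"
  by (metis add_uminus_conv_diff cinner_add_right cinner_minus_right)

lemma cinner_scaleR_right: "cinner x (r *\<^sub>R y) = r *\<^sub>R cinner x y" for x y :: "'h::chilbert_space"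
  by (simp add: scaleR_scaleC cinner_scaleC_right scaleR_conv_of_real)

text \<open>Rotating one argument by a phase turns the modulus into a real part, so the real
  Cauchy--Schwarz inequality suffices.\<close>

lemma cmod_cinner_le: "cmod (cinner x y) \<le> norm x * norm y" for x y :: "'h::chilbert_space"
proof (cases "cinner x y = 0")
  case False
  define c where "c = cnj (cinner x y) / cmod (cinner x y)"
  have c: "cmod c = 1"
    using False by (simp add: c_def norm_divide)
  have "c * cinner x y = cmod (cinner x y)"
    using False by (simp add: c_def complex_norm_square[symmetric] power2_eq_square
        field_simps complex_mod_mult_cnj)
  then have "cmod (cinner x y) = inner x (c *\<^sub>C y)"
    by (simp add: inner_eq_Re_cinner cinner_scaleC_right)
  also have "\<dots> \<le> norm x * norm (c *\<^sub>C y)"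
    by (rule norm_cauchy_schwarz)
  finally show ?thesis
    by (simp add: norm_scaleC c)
qed simp

lemma Im_cinner_right: "Im (cinner x y) = - inner x (\<i> *\<^sub>C y)" for x y :: "'h::chilbert_space"
  by (simp add: inner_eq_Re_cinner cinner_scaleC_right)

lemma vector_eqI: "(\<And>x. inner x y = inner x z) \<Longrightarrow> y = z" for y z :: "'h::real_inner"
  by (metis inner_diff_right inner_eq_zero_iff right_minus_eq)

text \<open>The functional \<open>x \<mapsto> \<parallel>x\<parallel>\<^sup>2 - 2 f x\<close> is bounded below, and by the
  parallelogram law a minimising sequence is Cauchy; the minimiser represents \<open>f\<close>.\<close>

lemma riesz_representation:
  fixes f :: "'h::{real_inner,complete_space} \<Rightarrow> real"
  assumes "bounded_linear f"
  shows "\<exists>y. \<forall>x. f x = inner y x"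
proof -
  interpret f: bounded_linear f by fact
  define J where "J x = (norm x)\<^sup>2 - 2 * f x" for x
  obtain K where K: "\<And>x. \<bar>f x\<bar> \<le> norm x * K" "K \<ge> 0"
    using f.nonneg_bounded by auto
  have J_ge: "J x \<ge> - K\<^sup>2" for x
  proof -
    have "0 \<le> (norm x - K)\<^sup>2" by simp
    then show ?thesis
      using K(1)[of x] unfolding J_def by (simp add: power2_eq_square algebra_simps)
  qed
  define m where "m = (INF x. J x)"
  have bdd: "bdd_below (range J)"
    using J_ge by (intro bdd_belowI[of _ "- K\<^sup>2"]) auto
  have m_le: "m \<le> J x" for x
    unfolding m_def by (rule cINF_lower[OF bdd]) simp
  have "\<exists>x. J x < m + 1 / real (Suc n)" for n
  proof -
    have "Inf (range J) < m + 1 / real (Suc n)"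
      unfolding m_def by simp
    then show ?thesis
      using cInf_lessD[of "range J"] by auto
  qed
  then obtain X where X: "\<And>n. J (X n) < m + 1 / real (Suc n)"
    by metis
  have para: "(norm (x - y))\<^sup>2 = 2 * J x + 2 * J y - 4 * J ((1/2) *\<^sub>R (x + y))" for x y
  proof -
    have parallelogram: "(norm (x - y))\<^sup>2 + (norm (x + y))\<^sup>2 = 2 * (norm x)\<^sup>2 + 2 * (norm y)\<^sup>2"
      by (simp add: power2_norm_eq_inner inner_add_left inner_add_right inner_diff_left
          inner_diff_right inner_commute)
    have mid: "J ((1/2) *\<^sub>R (x + y)) = (norm (x + y))\<^sup>2 / 4 - (f x + f y)"
      unfolding J_def f.scaleR f.add norm_scaleR power_mult_distrib
      by (simp add: power_divide field_simps)
    have alg: "a = 2 * (p - 2 * u) + 2 * (q - 2 * v) - 4 * (b / 4 - (u + v))"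
      if "a + b = 2 * p + 2 * q" for a b p q u v :: real
      using that by (simp add: field_simps)
    show ?thesis
      unfolding mid unfolding J_def[of x] J_def[of y] by (rule alg[OF parallelogram])
  qed
  have dist_le: "(norm (X a - X b))\<^sup>2 \<le> 4 / real (Suc n)" if "a \<ge> n" "b \<ge> n" for a b n
  proof -
    have "1 / real (Suc a) \<le> 1 / real (Suc n)" "1 / real (Suc b) \<le> 1 / real (Suc n)"
      using that by (auto intro!: divide_left_mono)
    then show ?thesis
      using para[of "X a" "X b"] X[of a] X[of b] m_le[of "(1/2) *\<^sub>R (X a + X b)"] by linarith
  qed
  have "Cauchy X"
  proof (rule metric_CauchyI)
    fix e :: real assume "e > 0"
    then obtain n where n: "4 / e\<^sup>2 < real n"
      using reals_Archimedean2 by blast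
    then have "4 / e\<^sup>2 < real (Suc n)" by simp
    then have "4 / real (Suc n) < e\<^sup>2"
      using \<open>e > 0\<close> by (simp add: field_simps del: of_nat_Suc)
    have "dist (X a) (X b) < e" if "a \<ge> n" "b \<ge> n" for a b
    proof (rule power_less_imp_less_base)
      show "(dist (X a) (X b))\<^sup>2 < e\<^sup>2"
        unfolding dist_norm using dist_le[OF that] \<open>4 / real (Suc n) < e\<^sup>2\<close> by (rule order_le_less_trans)
    qed (use \<open>e > 0\<close> in simp)
    then show "\<exists>M. \<forall>a\<ge>M. \<forall>b\<ge>M. dist (X a) (X b) < e" by blast
  qed
  then obtain y where y: "X \<longlonglongrightarrow> y"
    using Cauchy_convergent_iff convergent_def by blast
  have "(\<lambda>n. J (X n)) \<longlonglongrightarrow> J y"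
    unfolding J_def by (intro tendsto_intros f.tendsto y)
  moreover have "(\<lambda>n. m + 1 / real (Suc n)) \<longlonglongrightarrow> m + 0"
    by (intro tendsto_intros LIMSEQ_Suc lim_1_over_n)
  ultimately have "J y \<le> m + 0"
    by (rule LIMSEQ_le) (use X in \<open>auto intro: less_imp_le\<close>)
  then have min: "J y \<le> J z" for z
    using m_le[of z] by simp
  have "f x = inner y x" for x
  proof -
    \<comment> \<open>The quadratic \<open>s \<mapsto> J (y + s x)\<close> is minimal at \<open>0\<close>, so its linear coefficient vanishes.\<close>
    define d where "d = inner y x - f x"
    have *: "0 \<le> 2 * s * d + s\<^sup>2 * (norm x)\<^sup>2" for s
    proof -
      have "J (y + s *\<^sub>R x) = J y + 2 * s * d + s\<^sup>2 * (norm x)\<^sup>2"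
        unfolding J_def d_def power2_norm_eq_inner f.add f.scale
        by (simp add: inner_add_left inner_add_right inner_commute[of x y] algebra_simps
            power2_eq_square)
      then show ?thesis using min[of "y + s *\<^sub>R x"] by simp
    qed
    have "d = 0"
    proof (cases "x = 0")
      case False
      have "0 \<le> - (d\<^sup>2 / (norm x)\<^sup>2)"
        using *[of "- d / (norm x)\<^sup>2"] False by (simp add: field_simps power2_eq_square)
      then show ?thesis using False by (simp add: field_simps)
    qed (simp add: d_def f.zero)
    then show ?thesis by (simp add: d_def)
  qed
  then show ?thesis by blast
qed

text \<open>The bridge from bilinear forms to operators, used for adjoints and for weak-* integrals.\<close>

lemma bounded_form_representation:
  fixes B :: "'h::{real_inner,complete_space} \<Rightarrow> 'h \<Rightarrow> real"
  assumes "bounded_bilinear B"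
  shows "\<exists>g :: 'h op. \<forall>x y. B x y = inner x (blinfun_apply g y)"
proof -
  interpret B: bounded_bilinear B by fact
  have "\<exists>z. \<forall>x. B x y = inner z x" for y
    by (rule riesz_representation) (rule B.bounded_linear_left)
  then obtain g where g: "\<And>x y. B x y = inner (g y) x" by metis
  obtain K where K: "\<And>x y. \<bar>B x y\<bar> \<le> norm x * norm y * K" "K \<ge> 0"
    using B.nonneg_bounded by auto
  have "bounded_linear g"
  proof (rule bounded_linear_intro[where K = K])
    show "g (y + z) = g y + g z" for y z
      by (rule vector_eqI) (metis B.add_right g inner_add_right inner_commute)
    show "g (r *\<^sub>R y) = r *\<^sub>R g y" for r y
      by (rule vector_eqI) (metis B.scaleR_right g inner_commute inner_scaleR_right real_scaleR_def)
    show "norm (g y) \<le> norm y * K" for y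
    proof (cases "g y = 0")
      case True
      then show ?thesis using K(2) by simp
    next
      case False
      have "norm (g y) * norm (g y) = B (g y) y"
        by (simp add: g power2_norm_eq_inner[symmetric] power2_eq_square)
      also have "\<dots> \<le> norm (g y) * (norm y * K)"
        using K(1)[of "g y" y] by (simp add: algebra_simps)
      finally show ?thesis using False by simp
    qed
  qed
  then show ?thesis
    by (intro exI[of _ "Blinfun g"]) (simp add: bounded_linear_Blinfun_apply g inner_commute)
qed

lemma bounded_opsD: "a \<in> bounded_ops \<Longrightarrow> blinfun_apply a (c *\<^sub>C x) = c *\<^sub>C blinfun_apply a x"
  by (simp add: bounded_ops_def)

text \<open>The existence half of the definite description in \<^const>\<open>adj\<close>. The representing operator is found for
  the real part of the form; the imaginary part follows by complex linearity.\<close>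

lemma adj_works:
  fixes a :: "'h::chilbert_space op"
  assumes "a \<in> bounded_ops"
  shows "cinner (blinfun_apply (adj a) x) y = cinner x (blinfun_apply a y)"
proof -
  have "bounded_bilinear (\<lambda>x y. inner (blinfun_apply a x) y)"
    by (rule bounded_bilinear.comp1[OF bounded_bilinear_inner blinfun.bounded_linear_right])
  then obtain b :: "'h op" where b: "inner (blinfun_apply a x) y = inner x (blinfun_apply b y)" for x y
    using bounded_form_representation by blast
  have b_adj: "cinner (blinfun_apply b x) y = cinner x (blinfun_apply a y)" for x y
  proof -
    have Re: "inner (blinfun_apply b x) z = inner x (blinfun_apply a z)" for z
      by (metis b inner_commute)
    show ?thesis
      using Re[of y] Re[of "\<i> *\<^sub>C y"]
      by (intro complex_eqI)
        (simp_all only: inner_eq_Re_cinner Im_cinner_right bounded_opsD[OF assms])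
  qed
  have "adj a = b"
    unfolding adj_def
  proof (rule the_equality)
    fix b' :: "'h op"
    assume "\<forall>x y. cinner (blinfun_apply b' x) y = cinner x (blinfun_apply a y)"
    then have "inner y (blinfun_apply b' x) = inner y (blinfun_apply b x)" for x y
      by (metis b_adj inner_commute inner_eq_Re_cinner)
    then show "b' = b"
      by - (rule blinfun_eqI, rule vector_eqI, blast)
  qed (simp add: b_adj)
  then show ?thesis by (simp add: b_adj)
qed

lemma cinner_abs_sq:
  assumes "a \<in> bounded_ops"
  shows "cinner x (blinfun_apply (abs_sq a) y) = cinner (blinfun_apply a x) (blinfun_apply a y)"
  by (metis abs_sq_def adj_works assms blinfun_apply_blinfun_compose cinner_commute)

lemma inner_abs_sq:
  assumes "a \<in> bounded_ops"
  shows "inner x (blinfun_apply (abs_sq a) x) = (norm (blinfun_apply a x))\<^sup>2"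
  by (simp add: inner_eq_Re_cinner cinner_abs_sq[OF assms] cinner_self)

definition positive_op :: "'h::chilbert_space op \<Rightarrow> bool" where
  "positive_op a \<longleftrightarrow> (\<forall>x. cinner x (blinfun_apply a x) \<in> \<real>\<^sub>\<ge>\<^sub>0)"

lemma positive_opD: "positive_op a \<Longrightarrow> 0 \<le> inner x (blinfun_apply a x)"
  by (metis complex_nonneg_Reals_iff inner_eq_Re_cinner positive_op_def)

lemma positive_op_abs_sq: "a \<in> bounded_ops \<Longrightarrow> positive_op (abs_sq a)"
  by (auto simp: positive_op_def cinner_abs_sq cinner_self complex_nonneg_Reals_iff)

text \<open>A real quadratic form over the complex numbers is symmetric: the form at \<open>x + \<i> y\<close> has
  vanishing imaginary part.\<close>

lemma positive_op_symmetric: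
  assumes "positive_op a" "a \<in> bounded_ops"
  shows "inner x (blinfun_apply a y) = inner (blinfun_apply a x) y"
proof -
  have Im: "Im (cinner z (blinfun_apply a z)) = 0" for z
    using assms(1) by (auto simp: positive_op_def complex_nonneg_Reals_iff)
  have "0 = Im (cinner (x + \<i> *\<^sub>C y) (blinfun_apply a (x + \<i> *\<^sub>C y)))"
    by (simp only: Im)
  also have "\<dots> = Re (cinner x (blinfun_apply a y)) - Re (cinner y (blinfun_apply a x))"
    by (simp add: blinfun.add_right bounded_opsD[OF assms(2)] cinner_add_right cinner_add_left
        cinner_scaleC_right cinner_scaleC_left Im)
  finally show ?thesis
    by (metis eq_iff_diff_eq_0 inner_commute inner_eq_Re_cinner)
qed

text \<open>The norm of a positive operator is controlled by its quadratic form, so operator inequalities give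
  norm inequalities.\<close>

lemma norm_positive_op_le:
  assumes "positive_op a" "a \<in> bounded_ops" "0 \<le> c"
    and le: "\<And>x. inner x (blinfun_apply a x) \<le> c * (norm x)\<^sup>2"
  shows "norm a \<le> c"
proof (rule norm_blinfun_bound[OF \<open>0 \<le> c\<close>])
  fix y
  show "norm (blinfun_apply a y) \<le> c * norm y"
  proof (cases "blinfun_apply a y = 0 \<or> y = 0")
    case False
    define w where "w = blinfun_apply a y"
    define x where "x = (norm y / norm w) *\<^sub>R w"
    have nx: "norm x = norm y" using False by (simp add: x_def w_def)
    \<comment> \<open>Polarisation, and the form is nonnegative at \<open>x - y\<close>.\<close>
    have "4 * inner x w = inner (x + y) (blinfun_apply a (x + y)) - inner (x - y) (blinfun_apply a (x - y))"
      using positive_op_symmetric[OF assms(1,2), of x y]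
      by (simp add: w_def blinfun.add_right blinfun.diff_right inner_add_left inner_add_right
          inner_diff_left inner_diff_right inner_commute)
    also have "\<dots> \<le> c * (norm (x + y))\<^sup>2"
      using le[of "x + y"] positive_opD[OF assms(1), of "x - y"] by linarith
    also have "\<dots> \<le> c * (norm y + norm y)\<^sup>2"
      using norm_triangle_ineq[of x y] nx \<open>0 \<le> c\<close> by (intro mult_left_mono power_mono) auto
    finally have "inner x w \<le> c * (norm y)\<^sup>2" by (simp add: power2_eq_square)
    moreover have "inner x w = norm y * norm w"
      using False by (simp add: x_def w_def power2_norm_eq_inner[symmetric] power2_eq_square)
    ultimately show ?thesis
      using False by (simp add: w_def power2_eq_square algebra_simps)
  qed (use \<open>0 \<le> c\<close> in auto)
qed

lemma inner_le_norm_op: "inner x (blinfun_apply a x) \<le> norm a * (norm x)\<^sup>2" for a :: "'h::real_inner op"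
proof -
  have "inner x (blinfun_apply a x) \<le> norm x * (norm a * norm x)"
    by (meson norm_blinfun norm_cauchy_schwarz mult_left_mono norm_ge_zero order_trans)
  then show ?thesis by (simp add: power2_eq_square algebra_simps)
qed

section \<open>The one-sided stable density of index one half\<close>

text \<open>The error function without its normalising factor.\<close>

definition gauss_int :: "real \<Rightarrow> real" where
  "gauss_int x = (LBINT t=0..x. exp (- t\<^sup>2))"

lemma DERIV_gauss_int: "(gauss_int has_real_derivative exp (- x\<^sup>2)) (at x)"
proof -
  define a b where "a = - \<bar>x\<bar> - 1" and "b = \<bar>x\<bar> + 1"
  have ab: "a < x" "x < b" "a < 0" "0 < b" by (auto simp: a_def b_def)
  have "((\<lambda>u. LBINT y=0..u. exp (- y\<^sup>2)) has_vector_derivative exp (- x\<^sup>2)) (at x within {a..b})"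
  proof -
    have "continuous_on {a..b} (\<lambda>y::real. exp (- y\<^sup>2))"
      by (intro continuous_intros)
    then show ?thesis
      using interval_integral_FTC2[of a 0 b "\<lambda>y. exp (- y\<^sup>2)" x] ab
      by (simp add: zero_ereal_def)
  qed
  then show ?thesis
    using ab by (simp add: gauss_int_def[abs_def] has_real_derivative_iff_has_vector_derivative
        at_within_Icc_at)
qed

lemma gauss_int_0 [simp]: "gauss_int 0 = 0"
  by (simp add: gauss_int_def zero_ereal_def)

lemma gauss_int_minus: "gauss_int (- x) = - gauss_int x"
proof -
  have "((\<lambda>x. gauss_int x + gauss_int (- x)) has_real_derivative 0) (at x)" for x
    by (auto intro!: derivative_eq_intros DERIV_chain2[OF DERIV_gauss_int] DERIV_gauss_int)
  then have "gauss_int x + gauss_int (- x) = gauss_int 0 + gauss_int (- 0)"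
    by (intro DERIV_isconst_all) blast
  then show ?thesis by simp
qed

lemma gauss_int_at_top: "(gauss_int \<longlongrightarrow> sqrt pi / 2) at_top"
proof -
  have "integrable lborel (\<lambda>x::real. indicator {0..} x *\<^sub>R exp (- x\<^sup>2))"
    and val: "(\<integral>x. indicator {0..} x *\<^sub>R exp (- x\<^sup>2 :: real) \<partial>lborel) = sqrt pi / 2"
    using gaussian_moment_0 unfolding has_bochner_integral_iff by auto
  then have "((\<lambda>y. \<integral> x. indicator {..y} x *\<^sub>R (indicator {0..} x *\<^sub>R exp (- x\<^sup>2)) \<partial>lborel) \<longlongrightarrow> sqrt pi / 2) at_top"
    using tendsto_integral_at_top[of lborel "\<lambda>x. indicator {0..} x *\<^sub>R exp (- x\<^sup>2) :: real"]
    unfolding val by simp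
  then show ?thesis
  proof (rule Lim_transform_eventually)
    show "\<forall>\<^sub>F y in at_top. (\<integral> x. indicator {..y} x *\<^sub>R (indicator {0..} x *\<^sub>R exp (- x\<^sup>2)) \<partial>lborel) = gauss_int y"
      using eventually_ge_at_top[of 0]
    proof eventually_elim
      case (elim y)
      have "(\<lambda>x. indicator {..y} x *\<^sub>R (indicator {0..} x *\<^sub>R exp (- x\<^sup>2))) = (\<lambda>x. indicator {0..y} x *\<^sub>R exp (- x\<^sup>2))"
        by (auto simp: fun_eq_iff indicator_def)
      then show ?case
        using elim by (simp add: gauss_int_def interval_integral_Icc zero_ereal_def set_lebesgue_integral_def)
    qed
  qed
qed

lemma gauss_int_at_bot: "(gauss_int \<longlongrightarrow> - (sqrt pi / 2)) at_bot"
proof -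
  have "((\<lambda>x. - gauss_int x) \<longlongrightarrow> - (sqrt pi / 2)) at_top"
    by (intro tendsto_intros gauss_int_at_top)
  then show ?thesis
    by (simp add: filterlim_at_bot_mirror gauss_int_minus)
qed

text \<open>The kernel that subordinates the Poisson semigroup: the density of the first hitting time of level
  \<open>t\<close> by a Brownian motion of variance \<open>2u\<close> at time \<open>u\<close>. It is extended by \<open>0\<close> so that integrals run
  over the whole line.\<close>

definition levy :: "real \<Rightarrow> real \<Rightarrow> real" where
  "levy t u = (if u > 0 then t * exp (- t\<^sup>2 / (4 * u)) * u powr (- 3 / 2) / (2 * sqrt pi) else 0)"

lemma levy_nonneg: "0 \<le> t \<Longrightarrow> 0 \<le> levy t u"
  by (simp add: levy_def)

lemma levy_measurable [measurable]: "levy t \<in> borel_measurable borel"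
  unfolding levy_def[abs_def] by measurable

lemma powr_minus_three_halves: "0 < u \<Longrightarrow> u powr (- 3 / 2) = 1 / sqrt u ^ 3"
  by (simp add: powr_half_sqrt[symmetric] powr_realpow[symmetric] powr_powr powr_minus_divide
      divide_minus_left del: powr_half_sqrt)

lemma levy_pos: "0 < u \<Longrightarrow> levy t u = t * exp (- t\<^sup>2 / (4 * u)) / (2 * sqrt pi * sqrt u ^ 3)"
  unfolding levy_def powr_minus_three_halves by simp

lemma levy_nonpos: "u \<le> 0 \<Longrightarrow> levy t u = 0"
  by (simp add: levy_def)

lemma levy_nonzeroD: "levy t u \<noteq> 0 \<Longrightarrow> 0 < u"
  by (cases "0 < u") (auto simp: levy_nonpos)

lemma levy_isCont:
  assumes "0 < u"
  shows "isCont (levy t) u"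
proof -
  have "isCont (\<lambda>u. t * exp (- t\<^sup>2 / (4 * u)) / (2 * sqrt pi * sqrt u ^ 3)) u"
    using assms by (intro continuous_intros) auto
  moreover have "\<forall>\<^sub>F u in nhds u. levy t u = t * exp (- t\<^sup>2 / (4 * u)) / (2 * sqrt pi * sqrt u ^ 3)"
    using eventually_nhds_in_open[of "{0<..}" u] assms
    by (auto simp: levy_pos elim!: eventually_mono)
  ultimately show ?thesis
    by (simp add: isCont_cong)
qed

text \<open>The substitution \<open>w = t / (2 \<surd>u)\<close> turns the kernel into a Gaussian.\<close>

lemma has_integral_levy:
  assumes "0 < t"
  shows "integrable lborel (levy t)" "(\<integral>u. levy t u \<partial>lborel) = 1"
proof -
  let ?F = "\<lambda>u. - (2 / sqrt pi) * gauss_int (t / (2 * sqrt u))"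
  have F: "(?F has_real_derivative levy t x) (at x)" if "0 < x" for x
  proof -
    define a where "a = sqrt x"
    have a: "a > 0" "x = a\<^sup>2" using that by (auto simp: a_def)
    have "((\<lambda>u. t / (2 * sqrt u)) has_real_derivative - t / (4 * a ^ 3)) (at x)"
      using that a(1)
      by (auto intro!: derivative_eq_intros simp flip: a_def)
        (simp add: field_simps power3_eq_cube)
    from DERIV_cmult[OF DERIV_chain2[OF DERIV_gauss_int this], of "- (2 / sqrt pi)"]
    have "(?F has_real_derivative - (2 / sqrt pi) * (exp (- (t / (2 * a))\<^sup>2) * (- t / (4 * a ^ 3)))) (at x)"
      by (simp flip: a_def)
    also have "- (2 / sqrt pi) * (exp (- (t / (2 * a))\<^sup>2) * (- t / (4 * a ^ 3))) = levy t x"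
      unfolding levy_pos[OF that] a_def[symmetric] using a
      by (simp add: power_divide power_mult_distrib)
    finally show ?thesis .
  qed
  have cont: "isCont (levy t) x" if "0 < x" for x
    using that by (rule levy_isCont)
  have A: "(?F \<longlongrightarrow> - (2 / sqrt pi) * (sqrt pi / 2)) (at_right 0)"
  proof (intro tendsto_intros filterlim_compose[OF gauss_int_at_top])
    show "filterlim (\<lambda>u. t / (2 * sqrt u)) at_top (at_right 0)"
      using assms by real_asymp
  qed
  have B: "(?F \<longlongrightarrow> - (2 / sqrt pi) * gauss_int 0) at_top"
  proof (intro tendsto_intros isCont_tendsto_compose[OF DERIV_isCont[OF DERIV_gauss_int]])
    show "((\<lambda>u. t / (2 * sqrt u)) \<longlongrightarrow> 0) at_top" by real_asymp
  qed
  note FTC = interval_integral_FTC_nonneg[where F = ?F and f = "levy t" and a = 0 and b = \<infinity>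
      and A = "- (2 / sqrt pi) * (sqrt pi / 2)" and B = "- (2 / sqrt pi) * gauss_int 0"]
  have int: "set_integrable lborel (einterval 0 \<infinity>) (levy t)"
    and val: "(LBINT x=0..\<infinity>. levy t x) = 1"
    using FTC A B F cont assms
    by (simp_all add: ereal_tendsto_simps levy_nonneg zero_ereal_def)
  have ind: "(\<lambda>u. indicator {0<..} u * levy t u) = levy t"
    by (auto simp: fun_eq_iff levy_nonpos indicator_def)
  show "integrable lborel (levy t)" "(\<integral>u. levy t u \<partial>lborel) = 1"
    using int val
    by (simp_all add: set_integrable_def set_lebesgue_integral_def interval_lebesgue_integral_def
       zero_ereal_def ind)
qed

text \<open>The function is \<open>(s p - t / p) / (2 \<surd>v)\<close> with \<open>p = \<surd>((v - u) / u)\<close>, the variable in which the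
  integrand of a convolution of two kernels becomes Gaussian.\<close>

lemma sqrt_quotient_deriv:
  assumes "0 < u" "u < v"
  shows "((\<lambda>u. (s * (sqrt (v - u) / sqrt u) - t * (sqrt u / sqrt (v - u))) / (2 * sqrt v))
     has_real_derivative
      - (v / (4 * sqrt v * sqrt u * sqrt (v - u))) * (s / u + t / (v - u))) (at u)"
proof -
  define a b where "a = sqrt u" and "b = sqrt (v - u)"
  have ab: "a > 0" "b > 0" "u = a\<^sup>2" "v - u = b\<^sup>2" "v = a\<^sup>2 + b\<^sup>2"
    using assms by (auto simp: a_def b_def)
  have D1: "((\<lambda>u. sqrt (v - u) / sqrt u) has_real_derivative - v / (2 * a ^ 3 * b)) (at u)"
    using assms ab(1,2)
    by (auto intro!: derivative_eq_intros simp flip: a_def b_def)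
      (simp add: ab(5) field_simps power2_eq_square power3_eq_cube)
  have D2: "((\<lambda>u. sqrt u / sqrt (v - u)) has_real_derivative v / (2 * a * b ^ 3)) (at u)"
    using assms ab(1,2)
    by (auto intro!: derivative_eq_intros simp flip: a_def b_def)
      (simp add: ab(5) field_simps power2_eq_square power3_eq_cube)
  have "(s * (- v / (2 * a ^ 3 * b)) - t * (v / (2 * a * b ^ 3))) / (2 * sqrt v) =
      - (v / (4 * sqrt v * a * b)) * (s / a\<^sup>2 + t / b\<^sup>2)"
    using ab(1,2) by (simp add: field_simps power2_eq_square power3_eq_cube)
      (simp add: diff_divide_distrib add_divide_distrib)
  then show ?thesis
    using DERIV_cdivide[OF DERIV_diff[OF DERIV_cmult[OF D1, of s] DERIV_cmult[OF D2, of t]], of "2 * sqrt v"]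
    by (simp flip: a_def b_def ab(3,4))
qed

text \<open>With \<open>p = \<surd>((v - u) / u)\<close> and \<open>z = (s p - t / p) / (2 \<surd>v)\<close> one has
  \<open>s\<^sup>2 / 4u + t\<^sup>2 / 4(v - u) = (s + t)\<^sup>2 / 4v + z\<^sup>2\<close>, and the convolution becomes a multiple of
  \<open>\<integral> (1 + p\<^sup>-\<^sup>2) exp (- z\<^sup>2) dp\<close>. Changing the sign of \<open>t\<close> in \<open>z\<close> adds the constant \<open>s t / v\<close> to \<open>z\<^sup>2\<close>, so
  \<open>z\<^sub>t\<close> and \<open>z\<^sub>-\<^sub>t\<close> have the same Gaussian up to a factor, while their derivatives are multiples of
  \<open>s + t p\<^sup>-\<^sup>2\<close> and \<open>s - t p\<^sup>-\<^sup>2\<close>. The weight \<open>1 + p\<^sup>-\<^sup>2\<close> is a combination of the two, which gives an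
  explicit antiderivative in terms of the error function.\<close>

lemma levy_convolution:
  assumes "0 < s" "0 < t"
  shows "integrable lborel (\<lambda>u. levy s u * levy t (v - u))"
    and "(\<integral>u. levy s u * levy t (v - u) \<partial>lborel) = levy (s + t) v"
proof -
  have "integrable lborel (\<lambda>u. levy s u * levy t (v - u)) \<and>
    (\<integral>u. levy s u * levy t (v - u) \<partial>lborel) = levy (s + t) v"
  proof (cases "v > 0")
    case False
    then have "levy s u = 0 \<or> levy t (v - u) = 0" for u
      by (cases "0 < u") (auto simp: levy_nonpos)
    then have "(\<lambda>u. levy s u * levy t (v - u)) = (\<lambda>u. 0)"
      by (simp add: fun_eq_iff)
    then show ?thesis using False by (simp add: levy_nonpos)
  next
    case v: True
    define z where "z r u = (s * (sqrt (v - u) / sqrt u) - r * (sqrt u / sqrt (v - u))) / (2 * sqrt v)" for r u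
    define E A B where "E = exp (- (s + t)\<^sup>2 / (4 * v))" and "A = (1 / s + 1 / t) / 2"
      and "B = (1 / s - 1 / t) / 2"
    \<comment> \<open>\<open>A\<close> and \<open>B\<close> solve \<open>A (s + t p\<^sup>-\<^sup>2) + B (s - t p\<^sup>-\<^sup>2) = 1 + p\<^sup>-\<^sup>2\<close>.\<close>
    define c where "c = E * (s * t / (4 * pi)) * (4 * sqrt v / v\<^sup>2)"
    define F where "F u = - c * (A * gauss_int (z t u) + B * exp (s * t / v) * gauss_int (z (- t) u))" for u
    let ?f = "\<lambda>u. levy s u * levy t (v - u)"
    have F: "(F has_real_derivative ?f u) (at u)" if u: "0 < u" "u < v" for u
    proof -
      define a b where "a = sqrt u" and "b = sqrt (v - u)"
      have ab: "a > 0" "b > 0" "u = a\<^sup>2" "v - u = b\<^sup>2" "v = a\<^sup>2 + b\<^sup>2"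
        using u by (auto simp: a_def b_def)
      let ?d = "\<lambda>r. - (v / (4 * sqrt v * a * b)) * (s / a\<^sup>2 + r / b\<^sup>2)"
      have z: "(z r has_real_derivative ?d r) (at u)" for r
        using sqrt_quotient_deriv[OF u, of s r]
        unfolding z_def[abs_def] by (simp flip: a_def b_def ab(3,4))
      have zu: "z r u = (s * (b / a) - r * (a / b)) / (2 * sqrt v)" for r
        by (simp add: z_def a_def b_def)
      have zsq: "(z r u)\<^sup>2 = (s * (b / a) - r * (a / b))\<^sup>2 / (4 * v)" for r
        unfolding zu using v by (simp add: power_divide power_mult_distrib)
      have e1: "exp (s * t / v) * exp (- (z (- t) u)\<^sup>2) = exp (- (z t u)\<^sup>2)"
        unfolding zsq exp_add[symmetric] using v ab(1,2)
        by (simp add: field_simps power2_eq_square)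
      have e2: "E * exp (- (z t u)\<^sup>2) = exp (- s\<^sup>2 / (4 * u)) * exp (- t\<^sup>2 / (4 * (v - u)))"
      proof -
        have "(s + t)\<^sup>2 / (4 * v) + (s * (b / a) - t * (a / b))\<^sup>2 / (4 * v) = s\<^sup>2 / (4 * a\<^sup>2) + t\<^sup>2 / (4 * b\<^sup>2)"
        proof -
          have "(s + t)\<^sup>2 + (s * (b / a) - t * (a / b))\<^sup>2 = v * (s\<^sup>2 / a\<^sup>2 + t\<^sup>2 / b\<^sup>2)"
            unfolding ab(5) using ab(1,2) by (simp add: field_simps power2_eq_square)
          then show ?thesis using v by (simp add: field_simps)
        qed
        then show ?thesis
          unfolding E_def zsq ab(4) exp_add[symmetric] by (simp add: ab(3))
      qed
      have "(F has_real_derivative - c * (A * (exp (- (z t u)\<^sup>2) * ?d t)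
          + B * exp (s * t / v) * (exp (- (z (- t) u)\<^sup>2) * ?d (- t)))) (at u)"
        unfolding F_def[abs_def]
        by (intro DERIV_cmult DERIV_add DERIV_chain2[OF DERIV_gauss_int z])
      also have "B * exp (s * t / v) * (exp (- (z (- t) u)\<^sup>2) * ?d (- t)) = B * exp (- (z t u)\<^sup>2) * ?d (- t)"
        by (simp flip: e1)
      also have "- c * (A * (exp (- (z t u)\<^sup>2) * ?d t) + B * exp (- (z t u)\<^sup>2) * ?d (- t))
          = c * exp (- (z t u)\<^sup>2) * (v / (4 * sqrt v * a * b)) * (A * (s / a\<^sup>2 + t / b\<^sup>2) + B * (s / a\<^sup>2 + - t / b\<^sup>2))"
      proof -
        have "- c * (A * (X * (- K * P)) + B * X * (- K * Q)) = c * X * K * (A * P + B * Q)"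
          for X K P Q :: real
          by (simp add: algebra_simps)
        then show ?thesis .
      qed
      also have "A * (s / a\<^sup>2 + t / b\<^sup>2) + B * (s / a\<^sup>2 + - t / b\<^sup>2) = v / (a\<^sup>2 * b\<^sup>2)"
        unfolding ab(5) A_def B_def using assms ab(1,2) by (simp add: field_simps)
      also have "c * exp (- (z t u)\<^sup>2) * (v / (4 * sqrt v * a * b)) * (v / (a\<^sup>2 * b\<^sup>2))
          = (E * exp (- (z t u)\<^sup>2)) * (s * t / (4 * pi)) / (a ^ 3 * b ^ 3)"
        unfolding c_def using v ab(1,2) by (simp add: power2_eq_square power3_eq_cube ac_simps)
      also have "\<dots> = ?f u"
      proof -
        have pi4: "4 * pi = (2 * sqrt pi) * (2 * sqrt pi)" by simp
        have vu: "0 < v - u" using u by simp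
        have "X * Y * (s * t / (k * k)) / (p * q) = (s * X / (k * p)) * (t * Y / (k * q))"
          for X Y k p q :: real
          by (simp add: ac_simps)
        then show ?thesis
          unfolding e2 pi4 levy_pos[OF u(1)] levy_pos[OF vu] a_def[symmetric] b_def[symmetric] .
      qed
      finally show ?thesis .
    qed
    have cont: "isCont ?f u" if "0 < u" "u < v" for u
      using that by (intro continuous_intros levy_isCont isCont_o2[where g = "levy t"]) auto
    have zlim: "filterlim (z r) at_top (at_right 0)" for r
      unfolding z_def using assms v by real_asymp
    have zlim1: "filterlim (z t) at_bot (at_left v)"
      unfolding z_def using assms v by real_asymp
    have zlim2: "filterlim (z (- t)) at_top (at_left v)"
      unfolding z_def using assms v by real_asymp
    \<comment> \<open>\<open>z t\<close> runs from \<open>\<infinity>\<close> to \<open>-\<infinity>\<close> and \<open>z (- t)\<close> tends to \<open>\<infinity>\<close> at both ends, so only the \<open>A\<close> term contributes.\<close>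
    let ?q = "sqrt pi / 2"
    have A: "(F \<longlongrightarrow> - c * (A * ?q + B * exp (s * t / v) * ?q)) (at_right 0)"
      unfolding F_def[abs_def]
      by (intro tendsto_intros filterlim_compose[OF gauss_int_at_top] zlim)
    have B: "(F \<longlongrightarrow> - c * (A * - ?q + B * exp (s * t / v) * ?q)) (at_left v)"
      unfolding F_def[abs_def]
      by (intro tendsto_intros filterlim_compose[OF gauss_int_at_top zlim2]
          filterlim_compose[OF gauss_int_at_bot zlim1])
    have val: "- c * (A * - ?q + B * exp (s * t / v) * ?q) - (- c * (A * ?q + B * exp (s * t / v) * ?q))
       = levy (s + t) v"
    proof -
      have "- c * (A * - ?q + B * exp (s * t / v) * ?q) - (- c * (A * ?q + B * exp (s * t / v) * ?q))
       = c * A * sqrt pi" by (simp add: algebra_simps)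
      also have "\<dots> = E * (s + t) / (2 * sqrt pi) * (sqrt v / v\<^sup>2)"
      proof -
        define q where "q = sqrt pi"
        have q: "pi = q * q" "q > 0" by (simp_all add: q_def)
        show ?thesis
          unfolding c_def A_def q_def[symmetric] unfolding q(1)
          using assms v q(2) by (simp add: field_simps)
      qed
      also have "sqrt v / v\<^sup>2 = 1 / sqrt v ^ 3"
      proof -
        define w where "w = sqrt v"
        have "v = w\<^sup>2" "w > 0" using v by (auto simp: w_def)
        then show ?thesis by (simp add: field_simps power2_eq_square power3_eq_cube)
      qed
      finally show ?thesis
        using v by (simp add: levy_pos E_def)
    qed
    have A': "((F \<circ> real_of_ereal) \<longlongrightarrow> - c * (A * ?q + B * exp (s * t / v) * ?q)) (at_right (ereal 0))"
      unfolding ereal_tendsto_simps1 by (rule A)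
    have B': "((F \<circ> real_of_ereal) \<longlongrightarrow> - c * (A * - ?q + B * exp (s * t / v) * ?q)) (at_left (ereal v))"
      unfolding ereal_tendsto_simps1 by (rule B)
    have int: "set_integrable lborel (einterval 0 (ereal v)) ?f"
      and eq: "(LBINT u=0..ereal v. ?f u) = levy (s + t) v"
      using interval_integral_FTC_nonneg[of "ereal 0" "ereal v" F ?f, OF _ _ _ _ A' B']
         v F cont assms val
      by (simp_all add: levy_nonneg zero_ereal_def)
    have ind: "(\<lambda>u. indicator {0<..<v} u * ?f u) = ?f"
      by (auto simp: fun_eq_iff indicator_def dest!: levy_nonzeroD)
    show ?thesis
      using int eq v
      by (simp add: set_integrable_def set_lebesgue_integral_def interval_lebesgue_integral_def
         zero_ereal_def ind)
  qed
  then show "integrable lborel (\<lambda>u. levy s u * levy t (v - u))"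
    and "(\<integral>u. levy s u * levy t (v - u) \<partial>lborel) = levy (s + t) v" by auto
qed

lemma levy_integrable_pair:
  assumes "0 < s" "0 < t"
  shows "integrable (lborel \<Otimes>\<^sub>M lborel) (\<lambda>(u, w). levy s u * levy t (w - u))"
proof (rule lborel_pair.Fubini_integrable)
  have shift: "integrable lborel (\<lambda>w. levy t (w - u)) \<and> (\<integral>w. levy t (w - u) \<partial>lborel) = 1" for u
    using lborel_integrable_real_affine_iff[of 1 "levy t" "- u"]
      lborel_integral_real_affine[of 1 "levy t" "- u"] has_integral_levy[OF assms(2)]
    by simp
  show "AE u in lborel. integrable lborel (\<lambda>w. case (u, w) of (u, w) \<Rightarrow> levy s u * levy t (w - u))"
    using shift by simp
  have "(\<integral>w. norm (levy s u * levy t (w - u)) \<partial>lborel) = levy s u" for u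
    using shift[of u] assms by (simp add: levy_nonneg)
  then show "integrable lborel (\<lambda>u. \<integral>w. norm (case (u, w) of (u, w) \<Rightarrow> levy s u * levy t (w - u)) \<partial>lborel)"
    using has_integral_levy[OF assms(1)] by simp
qed measurable

lemma levy_integrable_bounded:
  fixes h :: "real \<Rightarrow> 'a::{banach,second_countable_topology}"
  assumes "0 < t" and [measurable]: "h \<in> borel_measurable borel" and "\<And>u. norm (h u) \<le> C"
  shows "integrable lborel (\<lambda>u. levy t u *\<^sub>R h u)"
proof (rule Bochner_Integration.integrable_bound[where f = "\<lambda>u. C * levy t u"])
  show "AE u in lborel. norm (levy t u *\<^sub>R h u) \<le> norm (C * levy t u)"
    using assms(1) levy_nonneg[of t] order_trans[OF assms(3) abs_ge_self]
    by (intro always_eventually allI) (simp add: abs_mult mult.commute[of _ "levy t _"] mult_left_mono)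
qed (use has_integral_levy[OF assms(1)] in simp_all)

text \<open>Fubini's theorem turns the convolution identity into a semigroup law for averages of orbits.\<close>

lemma levy_integral_convolution:
  fixes h :: "real \<Rightarrow> 'a::{banach,second_countable_topology}"
  assumes "0 < s" "0 < t" and h[measurable]: "h \<in> borel_measurable borel" and C: "\<And>u. norm (h u) \<le> C"
  shows "(\<integral>u. levy s u *\<^sub>R (\<integral>v. levy t v *\<^sub>R h (u + v) \<partial>lborel) \<partial>lborel)
    = (\<integral>w. levy (s + t) w *\<^sub>R h w \<partial>lborel)"
proof -
  have C0: "0 \<le> C" using C[of 0] norm_ge_zero order_trans by blast
  define f where "f u w = (levy s u * levy t (w - u)) *\<^sub>R h w" for u w
  have int: "integrable (lborel \<Otimes>\<^sub>M lborel) (case_prod f)"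
  proof (rule Bochner_Integration.integrable_bound)
    show "integrable (lborel \<Otimes>\<^sub>M lborel) (\<lambda>x. C * (case x of (u, w) \<Rightarrow> levy s u * levy t (w - u)))"
      using levy_integrable_pair[OF assms(1,2)] by (rule integrable_mult_right)
    show "AE x in lborel \<Otimes>\<^sub>M lborel. norm (case_prod f x) \<le> norm (C * (case x of (u, w) \<Rightarrow> levy s u * levy t (w - u)))"
      using assms(1,2) C0 C
      by (intro always_eventually allI)
        (auto simp: f_def abs_mult levy_nonneg mult.commute[of C] intro!: mult_left_mono)
  qed (unfold f_def, measurable)
  have "levy s u *\<^sub>R (\<integral>v. levy t v *\<^sub>R h (u + v) \<partial>lborel) = (\<integral>w. f u w \<partial>lborel)" for u
    using lborel_integral_real_affine[of 1 "f u" u]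
    by (auto simp: f_def simp flip: scaleR_scaleR)
  then have "(\<integral>u. levy s u *\<^sub>R (\<integral>v. levy t v *\<^sub>R h (u + v) \<partial>lborel) \<partial>lborel)
      = (\<integral>u. (\<integral>w. f u w \<partial>lborel) \<partial>lborel)"
    by simp
  also have "\<dots> = (\<integral>w. (\<integral>u. f u w \<partial>lborel) \<partial>lborel)"
    by (rule lborel_pair.Fubini_integral[OF int, symmetric])
  also have "\<dots> = (\<integral>w. levy (s + t) w *\<^sub>R h w \<partial>lborel)"
    by (simp add: f_def levy_convolution[OF assms(1,2)])
  finally show ?thesis .
qed

section \<open>Von Neumann algebras\<close>

lemma commutant_bounded: "commutant S \<subseteq> bounded_ops"
  by (auto simp: commutant_def)

lemma commutant_id: "id_blinfun \<in> commutant S"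
  by (auto simp: commutant_def bounded_ops_def intro: blinfun_eqI)

lemma commutantD:
  assumes "a \<in> commutant S" "b \<in> S"
  shows "blinfun_apply a (blinfun_apply b x) = blinfun_apply b (blinfun_apply a x)"
proof -
  have "a o\<^sub>L b = b o\<^sub>L a"
    using assms by (auto simp: commutant_def)
  then show ?thesis
    by (metis blinfun_apply_blinfun_compose)
qed

lemma commutant_compose:
  assumes "a \<in> commutant S" "b \<in> commutant S"
  shows "a o\<^sub>L b \<in> commutant S"
proof -
  have "(a o\<^sub>L b) o\<^sub>L c = c o\<^sub>L (a o\<^sub>L b)" if "c \<in> S" for c
    by (rule blinfun_eqI) (simp add: commutantD[OF assms(1) that] commutantD[OF assms(2) that])
  then show ?thesis
    using assms by (auto simp: commutant_def bounded_ops_def)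
qed

lemma commutant_add:
  assumes "a \<in> commutant S" "b \<in> commutant S"
  shows "a + b \<in> commutant S"
  using assms
  by (auto simp: commutant_def bounded_ops_def blinfun.add_left scaleC_add_right
      bounded_bilinear.add_left[OF bounded_bilinear_blinfun_compose]
      bounded_bilinear.add_right[OF bounded_bilinear_blinfun_compose])

lemma op_scaleC_apply [simp]: "blinfun_apply (op_scaleC c a) x = c *\<^sub>C blinfun_apply a x"
  by (simp add: op_scaleC.rep_eq)

lemma op_scaleC_of_real: "op_scaleC (complex_of_real r) a = r *\<^sub>R a"
  by (rule blinfun_eqI) (simp add: blinfun.scaleR_left scaleR_scaleC)

lemma commutant_scaleC:
  assumes "S \<subseteq> bounded_ops" "a \<in> commutant S"
  shows "op_scaleC c a \<in> commutant S"
proof -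
  have "op_scaleC c a o\<^sub>L b = b o\<^sub>L op_scaleC c a" if "b \<in> S" for b
  proof (rule blinfun_eqI)
    fix x
    have b: "b \<in> bounded_ops" using assms(1) that by (rule subsetD)
    have "blinfun_apply a (blinfun_apply b x) = blinfun_apply b (blinfun_apply a x)"
      using assms(2) that by (rule commutantD)
    then show "blinfun_apply (op_scaleC c a o\<^sub>L b) x = blinfun_apply (b o\<^sub>L op_scaleC c a) x"
      by (simp add: bounded_opsD[OF b])
  qed
  then show ?thesis
    using assms(2) by (auto simp: commutant_def bounded_ops_def scaleC_scaleC mult.commute)
qed

context
  fixes M :: "'h::chilbert_space op set"
  assumes vN: "von_neumann_algebra M"
begin

lemma vN_commutant2: "commutant (commutant M) = M"
  using vN by (simp add: von_neumann_algebra_def)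

lemma vN_bounded: "a \<in> M \<Longrightarrow> a \<in> bounded_ops"
  using commutant_bounded vN_commutant2 by blast

lemma vN_id: "id_blinfun \<in> M"
  using commutant_id vN_commutant2 by metis

lemma vN_compose: "a \<in> M \<Longrightarrow> b \<in> M \<Longrightarrow> a o\<^sub>L b \<in> M"
  using commutant_compose vN_commutant2 by metis

lemma vN_add: "a \<in> M \<Longrightarrow> b \<in> M \<Longrightarrow> a + b \<in> M"
  using commutant_add vN_commutant2 by metis

lemma vN_scaleC: "a \<in> M \<Longrightarrow> op_scaleC c a \<in> M"
  using commutant_scaleC[OF commutant_bounded] vN_commutant2 by metis

lemma vN_scaleR: "a \<in> M \<Longrightarrow> r *\<^sub>R a \<in> M"
  using vN_scaleC op_scaleC_of_real by metis

lemma vN_diff: "a \<in> M \<Longrightarrow> b \<in> M \<Longrightarrow> a - b \<in> M"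
  using vN_add[OF _ vN_scaleR[of b "-1"], of a] by simp

lemma vN_zero: "0 \<in> M"
  using vN_scaleR[OF vN_id, of 0] by simp

lemma vN_adj: "a \<in> M \<Longrightarrow> adj a \<in> M"
  using vN by (simp add: von_neumann_algebra_def)

lemma vN_abs_sq: "a \<in> M \<Longrightarrow> abs_sq a \<in> M"
  by (simp add: abs_sq_def vN_compose vN_adj)

end

section \<open>Unital Schwarz maps\<close>

text \<open>The last clause is the Kadison--Schwarz inequality \<open>|\<Phi> f|\<^sup>2 \<le> \<Phi> |f|\<^sup>2\<close>: take \<open>y = \<Phi> f x\<close>. In the present form both
  sides depend linearly on \<open>\<Phi>\<close>, so the condition is stable under averaging.\<close>

definition schwarz_map :: "'h::chilbert_space op set \<Rightarrow> ('h op \<Rightarrow> 'h op) \<Rightarrow> bool" where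
  "schwarz_map M \<Phi> \<longleftrightarrow>
     (\<forall>f\<in>M. \<Phi> f \<in> M) \<and>
     (\<forall>f\<in>M. \<forall>g\<in>M. \<Phi> (f + g) = \<Phi> f + \<Phi> g) \<and>
     (\<forall>c. \<forall>f\<in>M. \<Phi> (op_scaleC c f) = op_scaleC c (\<Phi> f)) \<and>
     \<Phi> id_blinfun = id_blinfun \<and>
     (\<forall>g\<in>M. positive_op g \<longrightarrow> positive_op (\<Phi> g)) \<and>
     (\<forall>f\<in>M. \<forall>x y. 2 * inner y (blinfun_apply (\<Phi> f) x)
        \<le> (norm y)\<^sup>2 + inner x (blinfun_apply (\<Phi> (abs_sq f)) x))"

lemma norm_abs_sq:
  assumes "a \<in> bounded_ops" "abs_sq a \<in> bounded_ops"
  shows "norm (abs_sq a) \<le> (norm a)\<^sup>2"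
proof (rule norm_positive_op_le)
  show "inner x (blinfun_apply (abs_sq a) x) \<le> (norm a)\<^sup>2 * (norm x)\<^sup>2" for x
    by (simp add: inner_abs_sq[OF assms(1)] power_mult_distrib[symmetric] norm_blinfun power_mono)
qed (auto simp: assms positive_op_abs_sq)

context
  fixes M :: "'h::chilbert_space op set" and \<Phi>
  assumes vN: "von_neumann_algebra M" and \<Phi>: "schwarz_map M \<Phi>"
begin

lemma schwarz_in: "f \<in> M \<Longrightarrow> \<Phi> f \<in> M"
  and schwarz_add: "f \<in> M \<Longrightarrow> g \<in> M \<Longrightarrow> \<Phi> (f + g) = \<Phi> f + \<Phi> g"
  and schwarz_scaleC: "f \<in> M \<Longrightarrow> \<Phi> (op_scaleC c f) = op_scaleC c (\<Phi> f)"
  and schwarz_id: "\<Phi> id_blinfun = id_blinfun"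
  and schwarz_pos: "f \<in> M \<Longrightarrow> positive_op f \<Longrightarrow> positive_op (\<Phi> f)"
  and schwarz_ineq: "f \<in> M \<Longrightarrow> 2 * inner y (blinfun_apply (\<Phi> f) x)
        \<le> (norm y)\<^sup>2 + inner x (blinfun_apply (\<Phi> (abs_sq f)) x)"
  using \<Phi> unfolding schwarz_map_def by blast+

lemma schwarz_scaleR: "f \<in> M \<Longrightarrow> \<Phi> (r *\<^sub>R f) = r *\<^sub>R \<Phi> f"
  using schwarz_scaleC[of f "complex_of_real r"] by (simp add: op_scaleC_of_real)

lemma schwarz_diff: "f \<in> M \<Longrightarrow> g \<in> M \<Longrightarrow> \<Phi> (f - g) = \<Phi> f - \<Phi> g"
  using schwarz_add[of f "(-1) *\<^sub>R g"] schwarz_scaleR[of g "-1"] vN_scaleR[OF vN, of g "-1"]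
  by simp

lemma schwarz_norm_sq_le:
  assumes "f \<in> M"
  shows "(norm (blinfun_apply (\<Phi> f) x))\<^sup>2 \<le> inner x (blinfun_apply (\<Phi> (abs_sq f)) x)"
  using schwarz_ineq[OF assms, of "blinfun_apply (\<Phi> f) x" x]
  by (simp add: power2_norm_eq_inner)

lemma schwarz_mono:
  assumes "f \<in> M" "g \<in> M" "positive_op (g - f)"
  shows "inner x (blinfun_apply (\<Phi> f) x) \<le> inner x (blinfun_apply (\<Phi> g) x)"
proof -
  have "positive_op (\<Phi> (g - f))"
    using assms vN_diff[OF vN] schwarz_pos by blast
  then have "0 \<le> inner x (blinfun_apply (\<Phi> (g - f)) x)"
    by (rule positive_opD)
  then show ?thesis
    by (simp add: schwarz_diff assms blinfun.diff_left inner_diff_right)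
qed

lemma schwarz_le_norm:
  assumes "g \<in> M" "positive_op g"
  shows "inner x (blinfun_apply (\<Phi> g) x) \<le> norm g * (norm x)\<^sup>2"
proof -
  have "positive_op (norm g *\<^sub>R id_blinfun - g)"
    unfolding positive_op_def
  proof
    fix x
    have "Re (cinner x (blinfun_apply g x)) \<le> norm g * (norm x)\<^sup>2"
      using inner_le_norm_op[of x g] by (simp add: inner_eq_Re_cinner)
    moreover have "Im (cinner x (blinfun_apply g x)) = 0"
      using assms(2) by (auto simp: positive_op_def complex_nonneg_Reals_iff)
    ultimately show "cinner x (blinfun_apply (norm g *\<^sub>R id_blinfun - g) x) \<in> \<real>\<^sub>\<ge>\<^sub>0"
      by (simp add: blinfun.diff_left blinfun.scaleR_left cinner_diff_right cinner_scaleR_right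
          cinner_self complex_nonneg_Reals_iff)
  qed
  from schwarz_mono[OF assms(1) vN_scaleR[OF vN vN_id[OF vN]] this, of x] show ?thesis
    by (simp add: schwarz_scaleR vN_id[OF vN] schwarz_id blinfun.scaleR_left power2_norm_eq_inner)
qed

text \<open>\<open>|\<Phi> f|\<^sup>2 \<le> \<Phi> |f|\<^sup>2 \<le> \<parallel>f\<parallel>\<^sup>2 \<Phi> 1\<close>, and \<open>\<Phi> 1 = 1\<close>.\<close>

lemma schwarz_contraction:
  assumes "f \<in> M"
  shows "norm (\<Phi> f) \<le> norm f"
proof (rule norm_blinfun_bound)
  fix x
  have f: "f \<in> bounded_ops" "abs_sq f \<in> M" "abs_sq f \<in> bounded_ops"
    using assms vN vN_abs_sq vN_bounded by blast+
  have "(norm (blinfun_apply (\<Phi> f) x))\<^sup>2 \<le> norm (abs_sq f) * (norm x)\<^sup>2"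
    using schwarz_norm_sq_le[OF assms, of x] schwarz_le_norm[OF f(2) positive_op_abs_sq[OF f(1)], of x]
    by linarith
  also have "\<dots> \<le> (norm f * norm x)\<^sup>2"
    using norm_abs_sq[OF f(1,3)] by (simp add: power_mult_distrib mult_right_mono)
  finally show "norm (blinfun_apply (\<Phi> f) x) \<le> norm f * norm x"
    by (simp add: power2_le_iff_abs_le)
qed simp

end

text \<open>Complete positivity applied to the positive matrix with rows \<open>(f\<^sup>* f, f\<^sup>*)\<close> and \<open>(f, 1)\<close>.\<close>

lemma completely_positive_schwarz:
  assumes vN: "von_neumann_algebra M" and cp: "completely_positive M \<Phi>" and f: "f \<in> M"
    and into: "\<And>g. g \<in> M \<Longrightarrow> \<Phi> g \<in> M"
    and id: "\<Phi> id_blinfun = id_blinfun"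
    and pos: "\<And>g. g \<in> M \<Longrightarrow> positive_op g \<Longrightarrow> positive_op (\<Phi> g)"
  shows "2 * inner y (blinfun_apply (\<Phi> f) x)
    \<le> (norm y)\<^sup>2 + inner x (blinfun_apply (\<Phi> (abs_sq f)) x)"
proof -
  have fb: "f \<in> bounded_ops" using f vN_bounded[OF vN] by blast
  define a where "a i j = (if i = 0 then if j = (0::nat) then abs_sq f else adj f
      else if j = 0 then f else id_blinfun)" for i j :: nat
  have aM: "a i j \<in> M" for i j
    by (simp add: a_def vN vN_abs_sq vN_adj vN_id f)
  have sum2: "(\<Sum>i<2. h i) = h 0 + h 1" for h :: "nat \<Rightarrow> complex"
    by (simp add: numeral_2_eq_2)
  have "positive_matrix 2 a"
    unfolding positive_matrix_def
  proof
    fix \<xi> :: "nat \<Rightarrow> 'a"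
    have adj: "cinner u (blinfun_apply (adj f) v) = cinner (blinfun_apply f u) v" for u v
      by (metis adj_works[OF fb] cinner_commute)
    have "(\<Sum>i<2. \<Sum>j<2. cinner (\<xi> i) (blinfun_apply (a i j) (\<xi> j)))
        = cinner (blinfun_apply f (\<xi> 0) + \<xi> 1) (blinfun_apply f (\<xi> 0) + \<xi> 1)"
      by (simp add: sum2 a_def cinner_abs_sq[OF fb] adj cinner_add_left cinner_add_right)
    then show "(\<Sum>i<2. \<Sum>j<2. cinner (\<xi> i) (blinfun_apply (a i j) (\<xi> j))) \<in> \<real>\<^sub>\<ge>\<^sub>0"
      by (simp add: cinner_self complex_nonneg_Reals_iff)
  qed
  then have "positive_matrix 2 (\<lambda>i j. \<Phi> (a i j))"
    using cp aM unfolding completely_positive_def by blast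
  then have nonneg: "(\<Sum>i<2. \<Sum>j<2. cinner (\<xi> i) (blinfun_apply (\<Phi> (a i j)) (\<xi> j))) \<in> \<real>\<^sub>\<ge>\<^sub>0" for \<xi>
    unfolding positive_matrix_def by blast
  define q where "q = cinner x (blinfun_apply (\<Phi> (abs_sq f)) x)"
  define w z where "w v = cinner x (blinfun_apply (\<Phi> (adj f)) v)"
    and "z v = cinner v (blinfun_apply (\<Phi> f) x)" for v
  have main: "q + w v + z v + (norm v)\<^sup>2 \<in> \<real>\<^sub>\<ge>\<^sub>0" for v
    using nonneg[of "\<lambda>i. if i = 0 then x else v"]
    by (simp add: sum2 a_def id q_def w_def z_def cinner_self add.assoc)
  have q: "q \<in> \<real>\<^sub>\<ge>\<^sub>0"
    using pos[OF vN_abs_sq[OF vN f] positive_op_abs_sq[OF fb]]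
    by (simp add: q_def positive_op_def)
  have adjb: "\<Phi> (adj f) \<in> bounded_ops"
    using into vN_adj[OF vN f] vN_bounded[OF vN] by blast
  have Im: "Im (w v) + Im (z v) = 0" for v
    using main[of v] q by (auto simp: complex_nonneg_Reals_iff)
  \<comment> \<open>Reality of the form at \<open>\<i> y\<close> compares the real parts of the off-diagonal terms.\<close>
  have "Re (w y) = Re (z y)"
    using Im[of "\<i> *\<^sub>C y"]
    by (simp add: w_def z_def bounded_opsD[OF adjb] cinner_scaleC_right cinner_scaleC_left)
  moreover have "0 \<le> Re q + Re (w (- y)) + Re (z (- y)) + (norm y)\<^sup>2"
    using main[of "- y"] by (auto simp: complex_nonneg_Reals_iff)
  moreover have "w (- y) = - w y" "z (- y) = - z y"
    by (simp_all add: w_def z_def blinfun.minus_right cinner_minus_right)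
       (metis cinner_commute cinner_minus_right complex_cnj_minus)
  ultimately show ?thesis
    by (simp add: q_def z_def inner_eq_Re_cinner)
qed

section \<open>The weak-* topology\<close>

text \<open>Vector functionals separate operators, so weak-* integrals are determined by them.\<close>

lemma in_predual_vector: "in_predual M (\<lambda>a. cinner x (blinfun_apply a y))"
  unfolding in_predual_def
proof (intro exI conjI ballI)
  let ?\<xi> = "\<lambda>n::nat. if n = 0 then x else 0" and ?\<eta> = "\<lambda>n::nat. if n = 0 then y else 0"
  show "summable (\<lambda>n. (norm (?\<xi> n))\<^sup>2)" "summable (\<lambda>n. (norm (?\<eta> n))\<^sup>2)"
    by (rule summable_finite[of "{0}"]; simp)+
  show "cinner x (blinfun_apply a y) = (\<Sum>n. cinner (?\<xi> n) (blinfun_apply a (?\<eta> n)))" for a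
    by (subst suminf_finite[of "{0}"]) auto
qed

lemma norm_product_summable:
  fixes \<xi> \<eta> :: "nat \<Rightarrow> 'h::real_normed_vector"
  assumes "summable (\<lambda>n. (norm (\<xi> n))\<^sup>2)" "summable (\<lambda>n. (norm (\<eta> n))\<^sup>2)"
  shows "summable (\<lambda>n. norm (\<xi> n) * norm (\<eta> n))"
proof (rule summable_comparison_test'[where N = 0])
  show "summable (\<lambda>n. (norm (\<xi> n))\<^sup>2 + (norm (\<eta> n))\<^sup>2)"
    using assms by (rule summable_add)
  show "norm (norm (\<xi> n) * norm (\<eta> n)) \<le> (norm (\<xi> n))\<^sup>2 + (norm (\<eta> n))\<^sup>2" for n
  proof -
    have "0 \<le> norm (\<xi> n) * norm (\<eta> n)" by simp
    then show ?thesis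
      using sum_squares_bound[of "norm (\<xi> n)" "norm (\<eta> n)"]
      unfolding real_norm_def mult.assoc by linarith
  qed
qed

lemma cmod_cinner_op_le:
  "cmod (cinner x (blinfun_apply a y)) \<le> norm a * (norm x * norm y)" for a :: "'h::chilbert_space op"
proof -
  have "cmod (cinner x (blinfun_apply a y)) \<le> norm x * (norm a * norm y)"
    by (meson cmod_cinner_le norm_blinfun mult_left_mono norm_ge_zero order_trans)
  then show ?thesis by (simp add: algebra_simps)
qed

lemma in_predualE:
  fixes M :: "'h::chilbert_space op set"
  assumes "in_predual M \<phi>"
  obtains \<xi> \<eta> :: "nat \<Rightarrow> 'h" where "summable (\<lambda>n. norm (\<xi> n) * norm (\<eta> n))"
    "\<And>a. a \<in> M \<Longrightarrow> (\<lambda>n. cinner (\<xi> n) (blinfun_apply a (\<eta> n))) sums \<phi> a"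
proof -
  obtain \<xi> \<eta> :: "nat \<Rightarrow> 'h" where \<xi>\<eta>: "summable (\<lambda>n. (norm (\<xi> n))\<^sup>2)" "summable (\<lambda>n. (norm (\<eta> n))\<^sup>2)"
    "\<And>a. a \<in> M \<Longrightarrow> \<phi> a = (\<Sum>n. cinner (\<xi> n) (blinfun_apply a (\<eta> n)))"
    using assms unfolding in_predual_def by blast
  have S: "summable (\<lambda>n. norm (\<xi> n) * norm (\<eta> n))"
    by (rule norm_product_summable[OF \<xi>\<eta>(1,2)])
  moreover have "summable (\<lambda>n. cinner (\<xi> n) (blinfun_apply a (\<eta> n)))" for a
    by (rule summable_comparison_test'[where N = 0, OF summable_mult[OF S, of "norm a"]])
      (rule cmod_cinner_op_le)
  ultimately show ?thesis
    using that \<xi>\<eta>(3) by (metis summable_sums)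
qed

lemma in_predual_add:
  assumes "in_predual M \<phi>" "a \<in> M" "b \<in> M" "a + b \<in> M"
  shows "\<phi> (a + b) = \<phi> a + \<phi> b"
proof -
  obtain \<xi> \<eta> where S: "\<And>a. a \<in> M \<Longrightarrow> (\<lambda>n. cinner (\<xi> n) (blinfun_apply a (\<eta> n))) sums \<phi> a"
    using in_predualE[OF assms(1)] by metis
  have "(\<lambda>n. cinner (\<xi> n) (blinfun_apply (a + b) (\<eta> n))) sums (\<phi> a + \<phi> b)"
    using sums_add[OF S[OF assms(2)] S[OF assms(3)]]
    by (simp add: blinfun.add_left cinner_add_right)
  then show ?thesis
    using S[OF assms(4)] sums_unique2 by blast
qed

lemma in_predual_scaleC:
  assumes "in_predual M \<phi>" "a \<in> M" "op_scaleC c a \<in> M"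
  shows "\<phi> (op_scaleC c a) = c * \<phi> a"
proof -
  obtain \<xi> \<eta> where S: "\<And>a. a \<in> M \<Longrightarrow> (\<lambda>n. cinner (\<xi> n) (blinfun_apply a (\<eta> n))) sums \<phi> a"
    using in_predualE[OF assms(1)] by metis
  have "(\<lambda>n. cinner (\<xi> n) (blinfun_apply (op_scaleC c a) (\<eta> n))) sums (c * \<phi> a)"
    using sums_mult[OF S[OF assms(2)], of c] by (simp add: cinner_scaleC_right)
  then show ?thesis
    using S[OF assms(3)] sums_unique2 by blast
qed

lemma in_predual_bounded:
  assumes "in_predual M \<phi>"
  obtains C where "0 \<le> C" "\<And>a. a \<in> M \<Longrightarrow> cmod (\<phi> a) \<le> norm a * C"
proof -
  obtain \<xi> \<eta> where S: "summable (\<lambda>n. norm (\<xi> n) * norm (\<eta> n))"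
    "\<And>a. a \<in> M \<Longrightarrow> (\<lambda>n. cinner (\<xi> n) (blinfun_apply a (\<eta> n))) sums \<phi> a"
    using in_predualE[OF assms(1)] by metis
  show ?thesis
  proof
    show "0 \<le> (\<Sum>n. norm (\<xi> n) * norm (\<eta> n))"
      by (intro suminf_nonneg S(1)) simp
    show "cmod (\<phi> a) \<le> norm a * (\<Sum>n. norm (\<xi> n) * norm (\<eta> n))" if "a \<in> M" for a
    proof -
      have sn: "summable (\<lambda>n. norm (cinner (\<xi> n) (blinfun_apply a (\<eta> n))))"
        by (rule summable_comparison_test'[where N = 0, OF summable_mult[OF S(1), of "norm a"]])
          (simp add: cmod_cinner_op_le)
      have "cmod (\<phi> a) \<le> (\<Sum>n. norm (cinner (\<xi> n) (blinfun_apply a (\<eta> n))))"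
        using summable_norm[OF sn] sums_unique[OF S(2)[OF that]] by simp
      also have "\<dots> \<le> (\<Sum>n. norm a * (norm (\<xi> n) * norm (\<eta> n)))"
        by (rule suminf_le[OF _ sn summable_mult[OF S(1)]]) (rule cmod_cinner_op_le)
      also have "\<dots> = norm a * (\<Sum>n. norm (\<xi> n) * norm (\<eta> n))"
        by (rule suminf_mult[OF S(1)])
      finally show ?thesis .
    qed
  qed
qed

lemma openin_weak_star_preimage:
  "in_predual M \<phi> \<Longrightarrow> open U \<Longrightarrow> openin (weak_star M) {a \<in> M. \<phi> a \<in> U}"
  unfolding weak_star_def by (rule topology_generated_by_Basis) blast

lemma topspace_weak_star: "topspace (weak_star M) = M"
proof
  show "topspace (weak_star M) \<subseteq> M"
    unfolding weak_star_def topology_generated_by_topspace by blast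
  have "openin (weak_star M) {a \<in> M. cinner 0 (blinfun_apply a 0) \<in> UNIV}"
    by (rule openin_weak_star_preimage[OF in_predual_vector]) simp
  then show "M \<subseteq> topspace (weak_star M)"
    using openin_subset by fastforce
qed

lemma limitin_weak_star_predual:
  assumes "limitin (weak_star M) g l F" "in_predual M \<phi>"
  shows "((\<lambda>x. \<phi> (g x)) \<longlongrightarrow> \<phi> l) F"
proof (rule topological_tendstoI)
  fix U assume U: "open U" "\<phi> l \<in> U"
  have "l \<in> M"
    using assms(1) unfolding limitin_def topspace_weak_star by blast
  then have "\<forall>\<^sub>F x in F. g x \<in> {a \<in> M. \<phi> a \<in> U}"
    using assms(1) openin_weak_star_preimage[OF assms(2) U(1)] U(2) unfolding limitin_def by blast
  then show "\<forall>\<^sub>F x in F. \<phi> (g x) \<in> U"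
    by eventually_elim simp
qed

text \<open>Basic weak-* neighbourhoods involve only finitely many functionals of the predual.\<close>

lemma weak_star_open_basic:
  assumes "openin (weak_star M) V" "a \<in> V"
  shows "\<exists>S e. finite S \<and> e > 0 \<and> (\<forall>\<phi>\<in>S. in_predual M \<phi>) \<and>
    (\<forall>b\<in>M. (\<forall>\<phi>\<in>S. dist (\<phi> b) (\<phi> a) < e) \<longrightarrow> b \<in> V)"
proof -
  have "generate_topology_on {{a \<in> M. \<phi> a \<in> U} |\<phi> U. in_predual M \<phi> \<and> open U} V"
    using assms(1) unfolding weak_star_def by (rule openin_topology_generated_by)
  then show ?thesis using assms(2)
  proof (induction arbitrary: a rule: generate_topology_on.induct)
    case (Int V W)
    from Int.IH(1)[of a] Int.prems obtain S e where S: "finite S" "e > 0"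
      "\<forall>\<phi>\<in>S. in_predual M \<phi>" "\<forall>b\<in>M. (\<forall>\<phi>\<in>S. dist (\<phi> b) (\<phi> a) < e) \<longrightarrow> b \<in> V" by auto
    from Int.IH(2)[of a] Int.prems obtain S' e' where S': "finite S'" "e' > 0"
      "\<forall>\<phi>\<in>S'. in_predual M \<phi>" "\<forall>b\<in>M. (\<forall>\<phi>\<in>S'. dist (\<phi> b) (\<phi> a) < e') \<longrightarrow> b \<in> W" by auto
    show ?case
      using S S' by (intro exI[of _ "S \<union> S'"] exI[of _ "min e e'"]) auto
  next
    case (UN K)
    then obtain k where k: "k \<in> K" "a \<in> k" by blast
    from UN.IH[OF k] k(1) show ?case by blast
  next
    case (Basis s)
    then obtain \<phi> U where \<phi>: "s = {a \<in> M. \<phi> a \<in> U}" "in_predual M \<phi>" "open U" by blast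
    then obtain e where "e > 0" "ball (\<phi> a) e \<subseteq> U"
      using Basis.prems open_contains_ball by blast
    then show ?case
      using \<phi> by (intro exI[of _ "{\<phi>}"] exI[of _ e]) (auto simp: dist_commute subset_iff)
  qed simp
qed

section \<open>Normal functionals\<close>

definition linear_functional_on :: "'h::chilbert_space op set \<Rightarrow> ('h op \<Rightarrow> complex) \<Rightarrow> bool" where
  "linear_functional_on M \<psi> \<longleftrightarrow> (\<forall>a\<in>M. \<forall>b\<in>M. \<psi> (a + b) = \<psi> a + \<psi> b) \<and>
     (\<forall>c. \<forall>a\<in>M. \<psi> (op_scaleC c a) = c * \<psi> a)"

context
  fixes M :: "'h::chilbert_space op set"
  assumes vN: "von_neumann_algebra M"
begin

lemma in_predual_linear: "in_predual M \<phi> \<Longrightarrow> linear_functional_on M \<phi>"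
  by (auto simp: linear_functional_on_def intro: in_predual_add in_predual_scaleC vN_add[OF vN] vN_scaleC[OF vN])

lemma linear_functional_comb:
  assumes "linear_functional_on M \<psi>" "a \<in> M" "b \<in> M"
  shows "\<psi> (a + op_scaleC c b) = \<psi> a + c * \<psi> b"
  using assms vN_scaleC[OF vN] by (simp add: linear_functional_on_def)

text \<open>If the common kernel of finitely many functionals is contained in the kernel of \<open>\<psi>\<close>, then \<open>\<psi>\<close> is a
  linear combination of them, so it inherits every property \<open>G\<close> that is stable under linear
  combinations.\<close>

lemma linear_functional_span_induct:
  assumes "finite S"
    and "\<forall>\<phi>\<in>S. linear_functional_on M \<phi> \<and> G \<phi>"
    and "linear_functional_on M \<psi>"
    and "\<And>a. a \<in> M \<Longrightarrow> (\<forall>\<phi>\<in>S. \<phi> a = 0) \<Longrightarrow> \<psi> a = 0"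
    and zero: "\<And>\<psi>. (\<And>a. a \<in> M \<Longrightarrow> \<psi> a = 0) \<Longrightarrow> G \<psi>"
    and comb: "\<And>\<psi> \<phi> \<psi>' c. linear_functional_on M \<psi> \<Longrightarrow> G \<psi> \<Longrightarrow> G \<phi> \<Longrightarrow>
      (\<And>a. a \<in> M \<Longrightarrow> \<psi>' a = \<psi> a + c * \<phi> a) \<Longrightarrow> G \<psi>'"
  shows "G \<psi>"
  using assms(1-4)
proof (induction S arbitrary: \<psi> rule: finite_induct)
  case empty
  then show ?case by (intro zero) auto
next
  case (insert \<phi> S)
  show ?case
  proof (cases "\<forall>a\<in>M. (\<forall>\<phi>\<in>S. \<phi> a = 0) \<longrightarrow> \<phi> a = 0")
    case True
    then show ?thesis
      using insert.prems by (intro insert.IH) auto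
  next
    case False
    then obtain a where a: "a \<in> M" "\<forall>\<phi>\<in>S. \<phi> a = 0" "\<phi> a \<noteq> 0" by blast
    define c where "c = \<psi> a / \<phi> a"
    define \<psi>' where "\<psi>' b = \<psi> b - c * \<phi> b" for b
    have lin: "linear_functional_on M \<psi>" "linear_functional_on M \<phi>"
      using insert.prems by auto
    then have lin': "linear_functional_on M \<psi>'"
      by (auto simp: linear_functional_on_def \<psi>'_def algebra_simps)
    have "G \<psi>'"
    proof (rule insert.IH)
      show "\<forall>\<phi>\<in>S. linear_functional_on M \<phi> \<and> G \<phi>" using insert.prems by simp
      show "linear_functional_on M \<psi>'" by (rule lin')
      fix b assume b: "b \<in> M" "\<forall>\<phi>\<in>S. \<phi> b = 0"
      \<comment> \<open>Subtracting a multiple of \<open>a\<close> moves \<open>b\<close> into the kernel of \<open>\<phi>\<close> as well.\<close>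
      let ?d = "- (\<phi> b / \<phi> a)"
      have "\<psi> (b + op_scaleC ?d a) = 0"
      proof (rule insert.prems(3))
        show "b + op_scaleC ?d a \<in> M"
          using a b vN_add[OF vN] vN_scaleC[OF vN] by blast
        show "\<forall>\<phi>'\<in>insert \<phi> S. \<phi>' (b + op_scaleC ?d a) = 0"
          using insert.prems(1) a b by (auto simp: linear_functional_comb)
      qed
      then show "\<psi>' b = 0"
        using a(3) by (simp add: linear_functional_comb lin a(1) b(1) \<psi>'_def c_def)
    qed
    then show ?thesis
      using insert.prems(1) lin' by (intro comb[of \<psi>' \<phi> \<psi> c]) (auto simp: \<psi>'_def)
  qed
qed

text \<open>A weak-* continuous functional is bounded by \<open>1\<close> on a basic neighbourhood of \<open>0\<close>, hence by
  homogeneity it vanishes on the common kernel of the functionals that define this neighbourhood.\<close>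

lemma weak_star_continuous_kernel:
  assumes lin: "linear_functional_on M \<psi>"
    and cont: "openin (weak_star M) {a \<in> M. cmod (\<psi> a) < 1}"
  obtains S where "finite S" "\<forall>\<phi>\<in>S. in_predual M \<phi>"
    "\<And>a. a \<in> M \<Longrightarrow> (\<forall>\<phi>\<in>S. \<phi> a = 0) \<Longrightarrow> \<psi> a = 0"
proof -
  have z: "\<phi> 0 = 0" if "linear_functional_on M \<phi>" for \<phi>
    using that vN_zero[OF vN] unfolding linear_functional_on_def by (metis add.right_neutral add_left_imp_eq)
  have "0 \<in> {a \<in> M. cmod (\<psi> a) < 1}"
    using vN_zero[OF vN] z[OF lin] by simp
  from weak_star_open_basic[OF cont this] obtain S e where S: "finite S" "e > 0"
    "\<forall>\<phi>\<in>S. in_predual M \<phi>"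
    "\<forall>b\<in>M. (\<forall>\<phi>\<in>S. dist (\<phi> b) (\<phi> 0) < e) \<longrightarrow> b \<in> {a \<in> M. cmod (\<psi> a) < 1}" by blast
  have "\<psi> a = 0" if a: "a \<in> M" "\<forall>\<phi>\<in>S. \<phi> a = 0" for a
  proof (rule ccontr)
    assume nz: "\<psi> a \<noteq> 0"
    let ?b = "op_scaleC (1 / \<psi> a) a"
    have "\<forall>\<phi>\<in>S. dist (\<phi> ?b) (\<phi> 0) < e"
    proof
      fix \<phi> assume "\<phi> \<in> S"
      then have \<phi>: "in_predual M \<phi>" "\<phi> a = 0" using S(3) a(2) by auto
      then show "dist (\<phi> ?b) (\<phi> 0) < e"
        using in_predual_scaleC[OF \<phi>(1) a(1) vN_scaleC[OF vN a(1)]] z[OF in_predual_linear[OF \<phi>(1)]] S(2)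
        by simp
    qed
    then have "cmod (\<psi> ?b) < 1"
      using S(4) vN_scaleC[OF vN a(1)] by blast
    then show False
      using lin a(1) nz by (simp add: linear_functional_on_def)
  qed
  then show ?thesis using that S by blast
qed

end

text \<open>Sampling at the next grid point of mesh \<open>1 / (i + 1)\<close> to the right gives measurable step functions
  that converge by right continuity.\<close>

lemma borel_measurable_right_continuous:
  fixes h :: "real \<Rightarrow> 'a::metric_space"
  assumes "\<And>u. (h \<longlongrightarrow> h u) (at_right u)"
  shows "h \<in> borel_measurable borel"
proof (rule borel_measurable_LIMSEQ_metric)
  let ?r = "\<lambda>i u. (real_of_int \<lfloor>real (Suc i) * u\<rfloor> + 1) / real (Suc i)"
  show "(\<lambda>u. h (?r i u)) \<in> borel_measurable borel" for i
    by (rule measurable_compose[where N = "count_space UNIV" and g = "\<lambda>k. h ((real_of_int k + 1) / real (Suc i))"])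
      measurable
  show "(\<lambda>i. h (?r i u)) \<longlonglongrightarrow> h u" for u
  proof (rule filterlim_compose[OF assms])
    have gt: "u < ?r i u" for i
    proof -
      have "real (Suc i) * u < real_of_int \<lfloor>real (Suc i) * u\<rfloor> + 1" by linarith
      then show ?thesis by (simp add: pos_less_divide_eq mult.commute del: of_nat_Suc)
    qed
    have le: "?r i u \<le> u + 1 / real (Suc i)" for i
    proof -
      have "(u + 1 / real (Suc i)) * real (Suc i) = real (Suc i) * u + 1"
        by (simp add: field_simps del: of_nat_Suc)
      moreover have "real_of_int \<lfloor>real (Suc i) * u\<rfloor> \<le> real (Suc i) * u"
        by (rule of_int_floor_le)
      ultimately have "real_of_int \<lfloor>real (Suc i) * u\<rfloor> + 1 \<le> (u + 1 / real (Suc i)) * real (Suc i)"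
        by linarith
      then show ?thesis by (simp add: pos_divide_le_eq del: of_nat_Suc)
    qed
    have lim: "(\<lambda>i. u + 1 / real (Suc i)) \<longlonglongrightarrow> u + 0"
      by (intro tendsto_intros LIMSEQ_Suc lim_1_over_n)
    have "(\<lambda>i. ?r i u) \<longlonglongrightarrow> u"
    proof (rule tendsto_sandwich[OF _ _ tendsto_const])
      show "\<forall>\<^sub>F i in sequentially. u \<le> ?r i u"
        using gt by (intro always_eventually allI less_imp_le)
      show "\<forall>\<^sub>F i in sequentially. ?r i u \<le> u + 1 / real (Suc i)"
        using le by (intro always_eventually allI)
      show "(\<lambda>i. u + 1 / real (Suc i)) \<longlonglongrightarrow> u" using lim by simp
    qed
    then show "filterlim (\<lambda>i. ?r i u) (at_right u) sequentially"
      unfolding filterlim_at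
      using gt by (auto intro!: always_eventually less_imp_neq[symmetric] simp del: of_nat_Suc)
  qed
qed

section \<open>The subordinated semigroup\<close>

text \<open>Extended by \<open>0\<close> to negative times, where nothing is assumed about \<open>T\<close>.\<close>

definition orbit :: "(real \<Rightarrow> 'h::chilbert_space op \<Rightarrow> 'h op) \<Rightarrow> ('h op \<Rightarrow> complex) \<Rightarrow> 'h op \<Rightarrow> real \<Rightarrow> complex" where
  "orbit T \<phi> f u = (if 0 \<le> u then \<phi> (T u f) else 0)"

context
  fixes M :: "'h::chilbert_space op set" and \<tau> T
  assumes vN: "von_neumann_algebra M" and ms: "markov_semigroup M \<tau> T"
begin

lemma T_in: "0 \<le> t \<Longrightarrow> f \<in> M \<Longrightarrow> T t f \<in> M"
  using ms by (simp add: markov_semigroup_def)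

lemma T_add: "0 \<le> t \<Longrightarrow> f \<in> M \<Longrightarrow> g \<in> M \<Longrightarrow> T t (f + g) = T t f + T t g"
  using ms by (simp add: markov_semigroup_def)

lemma T_scaleC: "0 \<le> t \<Longrightarrow> f \<in> M \<Longrightarrow> T t (op_scaleC c f) = op_scaleC c (T t f)"
  using ms by (simp add: markov_semigroup_def)

lemma T_semigroup: "0 \<le> t \<Longrightarrow> 0 \<le> s \<Longrightarrow> f \<in> M \<Longrightarrow> T (t + s) f = T t (T s f)"
  using ms by (simp add: markov_semigroup_def)

lemma T_normal: "0 \<le> t \<Longrightarrow> continuous_map (weak_star M) (weak_star M) (T t)"
  using ms by (simp add: markov_semigroup_def)

lemma T_cp: "0 \<le> t \<Longrightarrow> completely_positive M (T t)"
  using ms by (simp add: markov_semigroup_def)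

lemma T_id: "0 \<le> t \<Longrightarrow> T t id_blinfun = id_blinfun"
  using ms by (simp add: markov_semigroup_def)

lemma T_lim: "f \<in> M \<Longrightarrow> limitin (weak_star M) (\<lambda>t. T t f) f (at_right 0)"
  using ms by (simp add: markov_semigroup_def)

lemma T_positive:
  assumes "0 \<le> t" "g \<in> M" "positive_op g"
  shows "positive_op (T t g)"
proof -
  have sum1: "(\<Sum>i<1. h i) = h 0" for h :: "nat \<Rightarrow> complex" by simp
  have "positive_matrix 1 (\<lambda>i j. g)"
    using assms(3) unfolding positive_matrix_def positive_op_def sum1 by blast
  then have "positive_matrix 1 (\<lambda>i j. T t g)"
    using T_cp[OF assms(1), unfolded completely_positive_def, rule_format, of 1 "\<lambda>i j. g"] assms(2)
    by simp
  then have "cinner (\<xi> 0) (blinfun_apply (T t g) (\<xi> 0)) \<in> \<real>\<^sub>\<ge>\<^sub>0" for \<xi> :: "nat \<Rightarrow> 'h"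
    unfolding positive_matrix_def sum1 by blast
  from this[of "\<lambda>_. x" for x] show ?thesis
    by (simp add: positive_op_def)
qed

lemma T_schwarz: 
  assumes "0 \<le> t"
  shows "schwarz_map M (T t)"
  unfolding schwarz_map_def
proof (intro conjI ballI allI impI)
  show "2 * inner y (blinfun_apply (T t f) x) \<le> (norm y)\<^sup>2 + inner x (blinfun_apply (T t (abs_sq f)) x)"
    if "f \<in> M" for f x y
    by (rule completely_positive_schwarz[OF vN T_cp[OF assms] that T_in[OF assms] T_id[OF assms]
          T_positive[OF assms]])
qed (use assms in \<open>simp_all add: T_in T_add T_scaleC T_id T_positive\<close>)

text \<open>Continuity at time \<open>0\<close> is transported to time \<open>u\<close> by the normal map \<open>T u\<close>. Only right limits are
  available, which suffices for measurability.\<close>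

lemma T_right_continuous:
  assumes "0 \<le> u" "f \<in> M" "in_predual M \<phi>"
  shows "((\<lambda>v. \<phi> (T v f)) \<longlongrightarrow> \<phi> (T u f)) (at_right u)"
proof -
  have "limitin (weak_star M) (T u \<circ> (\<lambda>v. T v f)) (T u f) (at_right 0)"
    by (rule continuous_map_limit[OF T_normal[OF assms(1)] T_lim[OF assms(2)]])
  from limitin_weak_star_predual[OF this assms(3)]
  have "((\<lambda>v. \<phi> (T u (T v f))) \<longlongrightarrow> \<phi> (T u f)) (at_right 0)" by simp
  then have "((\<lambda>v. \<phi> (T (v + u) f)) \<longlongrightarrow> \<phi> (T u f)) (at_right 0)"
    by (rule Lim_transform_eventually)
      (use assms in \<open>auto simp: eventually_at_filter add.commute[of _ u] T_semigroup intro!: always_eventually\<close>)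
  then show ?thesis
    by (simp add: filterlim_at_right_to_0[of _ _ u])
qed

lemma orbit_measurable:
  assumes "f \<in> M" "in_predual M \<phi>"
  shows "orbit T \<phi> f \<in> borel_measurable borel"
proof (rule borel_measurable_right_continuous)
  fix u :: real
  show "(orbit T \<phi> f \<longlongrightarrow> orbit T \<phi> f u) (at_right u)"
  proof (cases "0 \<le> u")
    case True
    have "\<forall>\<^sub>F v in at_right u. \<phi> (T v f) = orbit T \<phi> f v"
      using eventually_at_right_less[of u] by eventually_elim (use True in \<open>simp add: orbit_def\<close>)
    from Lim_transform_eventually[OF T_right_continuous[OF True assms] this] show ?thesis
      using True by (simp add: orbit_def[of _ _ _ u])
  next
    case False
    have "\<forall>\<^sub>F v in at_right u. 0 = orbit T \<phi> f v"
      using eventually_at_right_real[of u 0] False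
      by (auto simp: orbit_def elim!: eventually_mono)
    from Lim_transform_eventually[OF tendsto_const this] show ?thesis
      using False by (simp add: orbit_def[of _ _ _ u])
  qed
qed

lemma T_contraction: "0 \<le> t \<Longrightarrow> f \<in> M \<Longrightarrow> norm (T t f) \<le> norm f"
  by (rule schwarz_contraction[OF vN T_schwarz])

lemma orbit_bounded:
  assumes "f \<in> M" "in_predual M \<phi>"
  obtains C where "\<And>u. norm (orbit T \<phi> f u) \<le> C"
proof -
  obtain C where C: "0 \<le> C" "\<And>a. a \<in> M \<Longrightarrow> cmod (\<phi> a) \<le> norm a * C"
    using in_predual_bounded[OF assms(2)] by blast
  have "norm (orbit T \<phi> f u) \<le> norm f * C" for u
  proof (cases "0 \<le> u")
    case True
    then have "cmod (\<phi> (T u f)) \<le> norm (T u f) * C"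
      using C(2) T_in assms(1) by blast
    also have "\<dots> \<le> norm f * C"
      using T_contraction[OF True assms(1)] C(1) by (rule mult_right_mono)
    finally show ?thesis using True by (simp add: orbit_def)
  qed (use C in \<open>simp add: orbit_def\<close>)
  then show ?thesis using that by blast
qed

lemma orbit_integrable:
  assumes "0 < t" "f \<in> M" "in_predual M \<phi>"
  shows "integrable lborel (\<lambda>u. levy t u *\<^sub>R orbit T \<phi> f u)"
proof -
  obtain C where "\<And>u. norm (orbit T \<phi> f u) \<le> C"
    using orbit_bounded[OF assms(2,3)] by blast
  then show ?thesis
    by (rule levy_integrable_bounded[OF assms(1) orbit_measurable[OF assms(2,3)]])
qed

abbreviation matrix_elem :: "'h \<Rightarrow> 'h \<Rightarrow> 'h op \<Rightarrow> complex" where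
  "matrix_elem x y \<equiv> (\<lambda>a. cinner x (blinfun_apply a y))"

text \<open>The averaged form is bounded because \<open>T\<close> is contractive and the kernel has mass \<open>1\<close>. Its operator
  commutes with the commutant of \<open>M\<close> because every \<open>T u f\<close> does.\<close>

lemma subordinated_operator_exists:
  assumes "0 < t" "f \<in> M"
  shows "\<exists>g\<in>M. \<forall>x y. cinner x (blinfun_apply g y) = (\<integral>u. levy t u *\<^sub>R orbit T (matrix_elem x y) f u \<partial>lborel)"
proof -
  define I where "I x y = (\<integral>u. levy t u *\<^sub>R orbit T (matrix_elem x y) f u \<partial>lborel)" for x y
  note int = orbit_integrable[OF assms in_predual_vector]
  have I_add_left: "I (x + x') y = I x y + I x' y" for x x' y
    unfolding I_def
    by (subst Bochner_Integration.integral_add[symmetric, OF int int])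
      (simp add: orbit_def cinner_add_left if_distrib scaleR_add_right cong: if_cong)
  have I_add_right: "I x (y + y') = I x y + I x y'" for x y y'
    unfolding I_def
    by (subst Bochner_Integration.integral_add[symmetric, OF int int])
      (simp add: orbit_def cinner_add_right blinfun.add_right if_distrib scaleR_add_right cong: if_cong)
  have Tb: "T u f \<in> bounded_ops" if "0 \<le> u" for u
    using T_in[OF that assms(2)] vN_bounded[OF vN] by blast
  have I_scale_right: "I x (c *\<^sub>C y) = c * I x y" for c x y
  proof -
    have "orbit T (matrix_elem x (c *\<^sub>C y)) f u = c * orbit T (matrix_elem x y) f u" for u
      by (simp add: orbit_def bounded_opsD[OF Tb] cinner_scaleC_right)
    then show ?thesis
      unfolding I_def by (simp flip: integral_mult_right_zero)
  qed
  have I_scale_left: "I (c *\<^sub>C x) y = cnj c * I x y" for c x y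
  proof -
    have "orbit T (matrix_elem (c *\<^sub>C x) y) f u = cnj c * orbit T (matrix_elem x y) f u" for u
      by (simp add: orbit_def cinner_scaleC_left)
    then show ?thesis
      unfolding I_def by (simp flip: integral_mult_right_zero)
  qed
  have I_bound: "cmod (I x y) \<le> norm x * norm y * norm f" for x y
  proof -
    have "cmod (I x y) \<le> (\<integral>u. levy t u * (norm x * norm y * norm f) \<partial>lborel)"
      unfolding I_def
    proof (rule Bochner_Integration.integral_norm_bound_integral[OF int])
      show "integrable lborel (\<lambda>u. levy t u * (norm x * norm y * norm f))"
        using has_integral_levy(1)[OF assms(1)] by (rule integrable_mult_left)
      fix u :: real
      have "norm (orbit T (matrix_elem x y) f u) \<le> norm x * norm y * norm f"
      proof (cases "0 \<le> u")
        case True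
        have "cmod (matrix_elem x y (T u f)) \<le> norm (T u f) * (norm x * norm y)"
          by (rule cmod_cinner_op_le)
        also have "\<dots> \<le> norm f * (norm x * norm y)"
          using T_contraction[OF True assms(2)] by (intro mult_right_mono) auto
        finally show ?thesis using True by (simp add: orbit_def mult.commute)
      qed (simp add: orbit_def)
      then show "norm (levy t u *\<^sub>R orbit T (matrix_elem x y) f u) \<le> levy t u * (norm x * norm y * norm f)"
        using levy_nonneg[of t u] assms(1) by (simp add: mult_left_mono)
    qed
    then show ?thesis
      using has_integral_levy(2)[OF assms(1)] by simp
  qed
  have "bounded_bilinear (\<lambda>x y. Re (I x y))"
  proof (rule bounded_bilinear.intro)
    show "\<exists>K. \<forall>x y. norm (Re (I x y)) \<le> norm x * norm y * K"
      using I_bound abs_Re_le_cmod order_trans unfolding real_norm_def by blast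
  qed (simp_all add: I_add_left I_add_right scaleR_scaleC I_scale_left I_scale_right)
  then obtain g :: "'h op" where g: "Re (I x y) = inner x (blinfun_apply g y)" for x y
    using bounded_form_representation by blast
  \<comment> \<open>Only real parts are known so far; complex linearity of \<open>g\<close> recovers the imaginary parts.\<close>
  have gC: "blinfun_apply g (c *\<^sub>C y) = c *\<^sub>C blinfun_apply g y" for c y
  proof (rule vector_eqI)
    fix x
    have "inner x (c *\<^sub>C blinfun_apply g y) = inner (cnj c *\<^sub>C x) (blinfun_apply g y)"
      by (simp add: inner_eq_Re_cinner cinner_scaleC_left cinner_scaleC_right)
    also have "\<dots> = inner x (blinfun_apply g (c *\<^sub>C y))"
      by (simp flip: g add: I_scale_left I_scale_right)
    finally show "inner x (blinfun_apply g (c *\<^sub>C y)) = inner x (c *\<^sub>C blinfun_apply g y)" by simp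
  qed
  have gI: "cinner x (blinfun_apply g y) = I x y" for x y
  proof (rule complex_eqI)
    show "Re (cinner x (blinfun_apply g y)) = Re (I x y)"
      by (simp add: g inner_eq_Re_cinner)
    show "Im (cinner x (blinfun_apply g y)) = Im (I x y)"
      unfolding Im_cinner_right gC[symmetric] g[symmetric] I_scale_right by simp
  qed
  have "g \<in> commutant (commutant M)"
    unfolding commutant_def[of "commutant M"]
  proof (intro CollectI conjI ballI)
    show "g \<in> bounded_ops" using gC by (simp add: bounded_ops_def)
    fix b assume b: "b \<in> commutant M"
    then have bb: "b \<in> bounded_ops" using commutant_bounded by blast
    show "g o\<^sub>L b = b o\<^sub>L g"
    proof (rule blinfun_eqI, rule vector_eqI)
      fix x y
      have "orbit T (matrix_elem x (blinfun_apply b y)) f u = orbit T (matrix_elem (blinfun_apply (adj b) x) y) f u" for u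
        using commutantD[OF b T_in[OF _ assms(2)]] by (simp add: orbit_def adj_works[OF bb])
      then have "I x (blinfun_apply b y) = I (blinfun_apply (adj b) x) y"
        by (simp add: I_def)
      then show "inner x (blinfun_apply (g o\<^sub>L b) y) = inner x (blinfun_apply (b o\<^sub>L g) y)"
        by (simp add: inner_eq_Re_cinner gI adj_works[OF bb, symmetric])
    qed
  qed
  then have "g \<in> M" using vN_commutant2[OF vN] by simp
  then show ?thesis using gI by (auto simp: I_def)
qed

text \<open>From vector functionals to the whole predual, by summing the defining series under the integral.\<close>

lemma subordinated_operator_predual:
  assumes "0 < t" "f \<in> M" "g \<in> M" "in_predual M \<phi>"
    and g: "\<And>x y. cinner x (blinfun_apply g y) = (\<integral>u. levy t u *\<^sub>R orbit T (matrix_elem x y) f u \<partial>lborel)"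
  shows "\<phi> g = (\<integral>u. levy t u *\<^sub>R orbit T \<phi> f u \<partial>lborel)"
proof -
  obtain \<xi> \<eta> where S: "summable (\<lambda>n. norm (\<xi> n) * norm (\<eta> n))"
    and \<phi>: "\<And>a. a \<in> M \<Longrightarrow> (\<lambda>n. matrix_elem (\<xi> n) (\<eta> n) a) sums \<phi> a"
    using in_predualE[OF assms(4)] by metis
  define F where "F n u = levy t u *\<^sub>R orbit T (matrix_elem (\<xi> n) (\<eta> n)) f u" for n u
  have int: "integrable lborel (F n)" for n
    unfolding F_def by (rule orbit_integrable[OF assms(1,2) in_predual_vector])
  have F_le: "norm (F n u) \<le> levy t u * norm f * (norm (\<xi> n) * norm (\<eta> n))" for n u
  proof (cases "0 \<le> u")
    case True
    have "cmod (matrix_elem (\<xi> n) (\<eta> n) (T u f)) \<le> norm (T u f) * (norm (\<xi> n) * norm (\<eta> n))"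
      by (rule cmod_cinner_op_le)
    also have "\<dots> \<le> norm f * (norm (\<xi> n) * norm (\<eta> n))"
      using T_contraction[OF True assms(2)] by (intro mult_right_mono) auto
    finally show ?thesis
      using True levy_nonneg[of t u] assms(1)
      by (simp add: F_def orbit_def mult.assoc mult_left_mono)
  qed (simp add: F_def orbit_def levy_nonpos)
  have F_sums: "(\<lambda>n. F n u) sums (levy t u *\<^sub>R orbit T \<phi> f u)" for u
    unfolding F_def orbit_def
    by (rule sums_scaleR_right) (auto intro: \<phi> T_in[OF _ assms(2)])
  have norm_sum: "summable (\<lambda>n. norm (F n u))" for u
    by (rule summable_comparison_test'[where N = 0, OF summable_mult[OF S, of "levy t u * norm f"]])
      (use F_le in simp)
  have int_sum: "summable (\<lambda>n. \<integral>u. norm (F n u) \<partial>lborel)"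
  proof (rule summable_comparison_test'[where N = 0, OF summable_mult[OF S, of "norm f"]])
    fix n
    have "(\<integral>u. norm (F n u) \<partial>lborel) \<le> (\<integral>u. levy t u * norm f * (norm (\<xi> n) * norm (\<eta> n)) \<partial>lborel)"
      using F_le int has_integral_levy(1)[OF assms(1)]
      by (intro integral_mono integrable_norm integrable_mult_left) auto
    then show "norm (\<integral>u. norm (F n u) \<partial>lborel) \<le> norm f * (norm (\<xi> n) * norm (\<eta> n))"
      using has_integral_levy(2)[OF assms(1)] by simp
  qed
  have "(\<integral>u. levy t u *\<^sub>R orbit T \<phi> f u \<partial>lborel) = (\<integral>u. (\<Sum>n. F n u) \<partial>lborel)"
    using F_sums by (simp add: sums_iff)
  also have "\<dots> = (\<Sum>n. \<integral>u. F n u \<partial>lborel)"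
    by (rule integral_suminf[OF int]) (use norm_sum int_sum in auto)
  also have "\<dots> = (\<Sum>n. matrix_elem (\<xi> n) (\<eta> n) g)"
    by (simp add: F_def g)
  also have "\<dots> = \<phi> g"
    using \<phi>[OF assms(3)] by (simp add: sums_iff)
  finally show ?thesis by simp
qed

text \<open>Identifies \<^const>\<open>poisson_semigroup\<close> by its matrix elements: an operator that matches them is the weak-*
  integral, and it is unique since vector functionals separate.\<close>

lemma poisson_eqI:
  assumes "0 < t" "f \<in> M" "g \<in> M"
    and g: "\<And>x y. cinner x (blinfun_apply g y) = (\<integral>u. levy t u *\<^sub>R orbit T (matrix_elem x y) f u \<partial>lborel)"
  shows "poisson_semigroup M T t f = g"
proof -
  \<comment> \<open>The normalising factor sits inside \<open>levy\<close> but outside the weak-* integral.\<close>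
  define c where "c = 2 * sqrt pi"
  have c: "c > 0" by (simp add: c_def)
  define F where "F u = (t * exp (- t\<^sup>2 / (4 * u)) * u powr (- 3 / 2)) *\<^sub>R T u f" for u
  have F_eq: "indicator {0<..} u *\<^sub>R \<phi> (F u) = c *\<^sub>R (levy t u *\<^sub>R orbit T \<phi> f u)" if "in_predual M \<phi>" for \<phi> u
  proof (cases "0 < u")
    case True
    have "\<phi> (r *\<^sub>R T u f) = r *\<^sub>R \<phi> (T u f)" for r
      using in_predual_scaleC[OF that, of "T u f" "complex_of_real r"] T_in[of u f] True assms(2)
        vN_scaleR[OF vN] by (simp add: op_scaleC_of_real scaleR_conv_of_real)
    then show ?thesis using True c
      by (simp add: F_def levy_def orbit_def c_def)
  qed (simp add: levy_nonpos)
  have \<phi>_scale: "\<phi> (c *\<^sub>R g) = c *\<^sub>R \<phi> g" if "in_predual M \<phi>" for \<phi>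
    using in_predual_scaleC[OF that assms(3), of "complex_of_real c"] vN_scaleR[OF vN assms(3)]
    by (simp add: op_scaleC_of_real scaleR_conv_of_real)
  have "weak_star_integral M {0<..} F = c *\<^sub>R g"
    unfolding weak_star_integral_def
  proof (rule the_equality)
    show "c *\<^sub>R g \<in> M \<and> (\<forall>\<phi>. in_predual M \<phi> \<longrightarrow>
        set_integrable lborel {0<..} (\<lambda>u. \<phi> (F u)) \<and> \<phi> (c *\<^sub>R g) = (LINT u:{0<..}|lborel. \<phi> (F u)))"
    proof (intro conjI allI impI)
      show "c *\<^sub>R g \<in> M" by (rule vN_scaleR[OF vN assms(3)])
      fix \<phi> assume \<phi>: "in_predual M \<phi>"
      show "set_integrable lborel {0<..} (\<lambda>u. \<phi> (F u))"
        unfolding set_integrable_def F_eq[OF \<phi>]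
        by (rule integrable_scaleR_right) (use orbit_integrable[OF assms(1,2) \<phi>] in simp)
      show "\<phi> (c *\<^sub>R g) = (LINT u:{0<..}|lborel. \<phi> (F u))"
        unfolding set_lebesgue_integral_def F_eq[OF \<phi>] \<phi>_scale[OF \<phi>]
          subordinated_operator_predual[OF assms(1-3) \<phi> g]
        by (rule integral_scaleR_right[symmetric])
    qed
    fix h assume h: "h \<in> M \<and> (\<forall>\<phi>. in_predual M \<phi> \<longrightarrow>
        set_integrable lborel {0<..} (\<lambda>u. \<phi> (F u)) \<and> \<phi> h = (LINT u:{0<..}|lborel. \<phi> (F u)))"
    have "matrix_elem x y h = matrix_elem x y (c *\<^sub>R g)" for x y
    proof -
      have "matrix_elem x y h = (LINT u:{0<..}|lborel. matrix_elem x y (F u))"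
        using h in_predual_vector by blast
      also have "\<dots> = c *\<^sub>R matrix_elem x y g"
        unfolding set_lebesgue_integral_def F_eq[OF in_predual_vector] g
        by (rule integral_scaleR_right)
      finally show ?thesis by (simp only: \<phi>_scale[OF in_predual_vector])
    qed
    then have "inner x (blinfun_apply h y) = inner x (blinfun_apply (c *\<^sub>R g) y)" for x y
      by (simp add: inner_eq_Re_cinner)
    then show "h = c *\<^sub>R g"
      by - (rule blinfun_eqI, rule vector_eqI, blast)
  qed
  then show ?thesis
    using assms(1) c unfolding poisson_semigroup_def F_def[symmetric] by (simp flip: c_def)
qed

lemma poisson_in: "0 < t \<Longrightarrow> f \<in> M \<Longrightarrow> poisson_semigroup M T t f \<in> M"
  and poisson_vector: "0 < t \<Longrightarrow> f \<in> M \<Longrightarrow>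
    cinner x (blinfun_apply (poisson_semigroup M T t f) y) = (\<integral>u. levy t u *\<^sub>R orbit T (matrix_elem x y) f u \<partial>lborel)"
  using subordinated_operator_exists poisson_eqI by metis+

lemma poisson_predual:
  assumes "0 < t" "f \<in> M" "in_predual M \<phi>"
  shows "\<phi> (poisson_semigroup M T t f) = (\<integral>u. levy t u *\<^sub>R orbit T \<phi> f u \<partial>lborel)"
  using subordinated_operator_predual[OF assms(1,2) poisson_in[OF assms(1,2)] assms(3)]
    poisson_vector[OF assms(1,2)] by blast

text \<open>Functionals such as \<open>a \<mapsto> \<langle>x, T\<^sub>u a y\<rangle>\<close> are weak-* continuous, but not given as elements of the
  predual. They are combinations of such elements on \<open>M\<close>, and the integral formula is preserved by
  linear combinations.\<close>

lemma normal_functional_poisson: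
  assumes "0 < t" "f \<in> M" "linear_functional_on M \<psi>"
    and "openin (weak_star M) {a \<in> M. cmod (\<psi> a) < 1}"
  shows "\<psi> (poisson_semigroup M T t f) = (\<integral>v. levy t v *\<^sub>R orbit T \<psi> f v \<partial>lborel)"
proof -
  let ?g = "poisson_semigroup M T t f"
  have g: "?g \<in> M" by (rule poisson_in[OF assms(1,2)])
  define G where "G \<psi> \<longleftrightarrow> integrable lborel (\<lambda>v. levy t v *\<^sub>R orbit T \<psi> f v) \<and>
    \<psi> ?g = (\<integral>v. levy t v *\<^sub>R orbit T \<psi> f v \<partial>lborel)" for \<psi>
  obtain S where S: "finite S" "\<forall>\<phi>\<in>S. in_predual M \<phi>"
    "\<And>a. a \<in> M \<Longrightarrow> (\<forall>\<phi>\<in>S. \<phi> a = 0) \<Longrightarrow> \<psi> a = 0"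
    using weak_star_continuous_kernel[OF vN assms(3,4)] by blast
  have "G \<psi>"
  proof (rule linear_functional_span_induct[OF vN S(1) _ assms(3) S(3)])
    show "\<forall>\<phi>\<in>S. linear_functional_on M \<phi> \<and> G \<phi>"
      using S(2) in_predual_linear[OF vN] orbit_integrable[OF assms(1,2)]
        poisson_predual[OF assms(1,2)] by (auto simp: G_def)
    show "G \<psi>" if "\<And>a. a \<in> M \<Longrightarrow> \<psi> a = 0" for \<psi>
    proof -
      have "orbit T \<psi> f v = 0" for v
        using that T_in[OF _ assms(2)] by (simp add: orbit_def)
      then show ?thesis using that[OF g] by (simp add: G_def)
    qed
    show "G \<psi>'" if "G \<psi>" "G \<phi>" "\<And>a. a \<in> M \<Longrightarrow> \<psi>' a = \<psi> a + c * \<phi> a" for \<psi> \<phi> \<psi>' c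
    proof -
      have "levy t v *\<^sub>R orbit T \<psi>' f v = levy t v *\<^sub>R orbit T \<psi> f v + c * (levy t v *\<^sub>R orbit T \<phi> f v)" for v
        using that(3)[OF T_in[OF _ assms(2)]] by (simp add: orbit_def algebra_simps)
      then show ?thesis
        using that(1,2) that(3)[OF g] unfolding G_def by (simp del: mult_scaleR_right)
    qed
  qed
  then show ?thesis by (simp add: G_def)
qed

lemma poisson_semigroup_law:
  assumes "0 < s" "0 < t" "f \<in> M"
  shows "poisson_semigroup M T s (poisson_semigroup M T t f) = poisson_semigroup M T (s + t) f"
proof (rule sym, rule poisson_eqI)
  let ?g = "poisson_semigroup M T t f"
  have g: "?g \<in> M" by (rule poisson_in[OF assms(2,3)])
  show "0 < s + t" "f \<in> M" using assms by auto
  show "poisson_semigroup M T s ?g \<in> M" by (rule poisson_in[OF assms(1) g])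
  fix x y :: 'h
  let ?\<phi> = "\<lambda>a. cinner x (blinfun_apply a y)"
  have inner: "levy s u *\<^sub>R orbit T ?\<phi> ?g u
      = levy s u *\<^sub>R (\<integral>v. levy t v *\<^sub>R orbit T ?\<phi> f (u + v) \<partial>lborel)" for u
  proof (cases "0 < u")
    case True
    then have u: "0 \<le> u" by simp
    define \<psi> where "\<psi> a = ?\<phi> (T u a)" for a
    have lin: "linear_functional_on M \<psi>"
      by (simp add: linear_functional_on_def \<psi>_def T_add[OF u] T_scaleC[OF u]
          blinfun.add_left cinner_add_right cinner_scaleC_right)
    have "openin (weak_star M) {a \<in> M. T u a \<in> {b \<in> M. ?\<phi> b \<in> ball 0 1}}"
      using openin_continuous_map_preimage[OF T_normal[OF u]
          openin_weak_star_preimage[OF in_predual_vector open_ball]]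
      unfolding topspace_weak_star .
    also have "{a \<in> M. T u a \<in> {b \<in> M. ?\<phi> b \<in> ball 0 1}} = {a \<in> M. cmod (\<psi> a) < 1}"
      using T_in[OF u] by (auto simp: \<psi>_def)
    finally have "\<psi> ?g = (\<integral>v. levy t v *\<^sub>R orbit T \<psi> f v \<partial>lborel)"
      by (rule normal_functional_poisson[OF assms(2,3) lin])
    also have "\<dots> = (\<integral>v. levy t v *\<^sub>R orbit T ?\<phi> f (u + v) \<partial>lborel)"
    proof (rule Bochner_Integration.integral_cong[OF refl])
      show "levy t v *\<^sub>R orbit T \<psi> f v = levy t v *\<^sub>R orbit T ?\<phi> f (u + v)" for v
        by (cases "0 < v") (use u in \<open>simp_all add: levy_nonpos orbit_def \<psi>_def T_semigroup[OF u _ assms(3)]\<close>)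
    qed
    finally show ?thesis using u by (simp add: orbit_def \<psi>_def)
  qed (simp add: levy_nonpos)
  obtain C where C: "\<And>u. norm (orbit T ?\<phi> f u) \<le> C"
    using orbit_bounded[OF assms(3) in_predual_vector] by blast
  show "cinner x (blinfun_apply (poisson_semigroup M T s ?g) y) = (\<integral>u. levy (s + t) u *\<^sub>R orbit T ?\<phi> f u \<partial>lborel)"
    unfolding poisson_vector[OF assms(1) g] inner
    by (rule levy_integral_convolution[OF assms(1,2) orbit_measurable[OF assms(3) in_predual_vector] C])
qed

lemma poisson_inner:
  assumes "0 < t" "f \<in> M"
  shows "integrable lborel (\<lambda>u. levy t u * Re (orbit T (\<lambda>a. cinner x (blinfun_apply a y)) f u))"
    and "inner x (blinfun_apply (poisson_semigroup M T t f) y)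
      = (\<integral>u. levy t u * Re (orbit T (\<lambda>a. cinner x (blinfun_apply a y)) f u) \<partial>lborel)"
  using integrable_Re[OF orbit_integrable[OF assms in_predual_vector, of x y]]
    integral_Re[OF orbit_integrable[OF assms in_predual_vector, of x y]]
  by (simp_all add: inner_eq_Re_cinner poisson_vector[OF assms])

lemma poisson_schwarz:
  assumes t: "0 < t"
  shows "schwarz_map M (poisson_semigroup M T t)"
  unfolding schwarz_map_def
proof (intro conjI ballI allI impI)
  let ?P = "poisson_semigroup M T t"
  note int = orbit_integrable[OF t _ in_predual_vector]
  show in_M: "?P f \<in> M" if "f \<in> M" for f
    by (rule poisson_in[OF t that])
  show "?P (f + g) = ?P f + ?P g" if f: "f \<in> M" and g: "g \<in> M" for f g
  proof (rule poisson_eqI[OF t])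
    fix x y :: 'h
    let ?\<phi> = "\<lambda>a. cinner x (blinfun_apply a y)"
    have "orbit T ?\<phi> (f + g) u = orbit T ?\<phi> f u + orbit T ?\<phi> g u" for u
      by (simp add: orbit_def T_add[OF _ f g] blinfun.add_left cinner_add_right)
    then show "cinner x (blinfun_apply (?P f + ?P g) y) = (\<integral>u. levy t u *\<^sub>R orbit T ?\<phi> (f + g) u \<partial>lborel)"
      by (simp add: blinfun.add_left cinner_add_right poisson_vector[OF t] f g scaleR_add_right int)
  qed (use f g in_M vN_add[OF vN] in auto)
  show "?P (op_scaleC c f) = op_scaleC c (?P f)" if f: "f \<in> M" for c f
  proof (rule poisson_eqI[OF t])
    fix x y :: 'h
    let ?\<phi> = "\<lambda>a. cinner x (blinfun_apply a y)"
    have "levy t u *\<^sub>R orbit T ?\<phi> (op_scaleC c f) u = c * (levy t u *\<^sub>R orbit T ?\<phi> f u)" for u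
      by (simp add: orbit_def T_scaleC[OF _ f] cinner_scaleC_right)
    then show "cinner x (blinfun_apply (op_scaleC c (?P f)) y) = (\<integral>u. levy t u *\<^sub>R orbit T ?\<phi> (op_scaleC c f) u \<partial>lborel)"
      by (simp add: cinner_scaleC_right poisson_vector[OF t f] del: mult_scaleR_right)
  qed (use f in_M vN_scaleC[OF vN] in auto)
  show "?P id_blinfun = id_blinfun"
  proof (rule poisson_eqI[OF t vN_id[OF vN] vN_id[OF vN]])
    fix x y :: 'h
    have eq: "levy t u *\<^sub>R orbit T (\<lambda>a. cinner x (blinfun_apply a y)) id_blinfun u = levy t u *\<^sub>R cinner x y" for u
      by (cases "0 < u") (simp_all add: levy_nonpos orbit_def T_id)
    show "cinner x (blinfun_apply id_blinfun y)
        = (\<integral>u. levy t u *\<^sub>R orbit T (\<lambda>a. cinner x (blinfun_apply a y)) id_blinfun u \<partial>lborel)"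
      unfolding eq using has_integral_levy[OF t] by simp
  qed
  show "positive_op (?P g)" if g: "g \<in> M" "positive_op g" for g
    unfolding positive_op_def
  proof
    fix x :: 'h
    let ?\<phi> = "\<lambda>a. cinner x (blinfun_apply a x)"
    have nn: "0 \<le> Re (orbit T ?\<phi> g u)" "Im (orbit T ?\<phi> g u) = 0" for u
      using T_positive[OF _ g]
      by (auto simp: orbit_def positive_op_def complex_nonneg_Reals_iff)
    have "0 \<le> Re (cinner x (blinfun_apply (?P g) x))"
      unfolding inner_eq_Re_cinner[symmetric] poisson_inner[OF t g(1)]
      using nn levy_nonneg t by (intro integral_nonneg_AE always_eventually) (simp add: less_imp_le)
    moreover have "Im (cinner x (blinfun_apply (?P g) x)) = 0"
      unfolding poisson_vector[OF t g(1)] integral_Im[OF int[OF g(1)], symmetric]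
      by (simp add: nn)
    ultimately show "cinner x (blinfun_apply (?P g) x) \<in> \<real>\<^sub>\<ge>\<^sub>0"
      by (simp add: complex_nonneg_Reals_iff)
  qed
  show "2 * inner y (blinfun_apply (?P f) x) \<le> (norm y)\<^sup>2 + inner x (blinfun_apply (?P (abs_sq f)) x)"
    if f: "f \<in> M" for f and x y :: 'h
  proof -
    let ?a = "\<lambda>u. Re (orbit T (\<lambda>a. cinner y (blinfun_apply a x)) f u)"
    let ?b = "\<lambda>u. Re (orbit T (\<lambda>a. cinner x (blinfun_apply a x)) (abs_sq f) u)"
    note a = poisson_inner[OF t f, of y x] and b = poisson_inner[OF t vN_abs_sq[OF vN f], of x x]
    have "2 * ?a u \<le> (norm y)\<^sup>2 + ?b u" for u
      using schwarz_ineq[OF vN T_schwarz f, of u y x]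
      by (simp add: orbit_def inner_eq_Re_cinner)
    then have "levy t u * (2 * ?a u) \<le> levy t u * ((norm y)\<^sup>2 + ?b u)" for u
      using levy_nonneg t by (intro mult_left_mono) auto
    then have "(\<integral>u. 2 * (levy t u * ?a u) \<partial>lborel) \<le> (\<integral>u. levy t u * (norm y)\<^sup>2 + levy t u * ?b u \<partial>lborel)"
      using a(1) b(1) has_integral_levy(1)[OF t]
      by (intro integral_mono Bochner_Integration.integrable_add integrable_mult_left integrable_mult_right)
        (auto simp: algebra_simps)
    then show ?thesis
      using a b has_integral_levy[OF t] by simp
  qed
qed

end

section \<open>Column seminorms\<close>

definition column_seminorm :: "(real \<Rightarrow> 'h::chilbert_space op \<Rightarrow> 'h op) \<Rightarrow> real \<Rightarrow> 'h op \<Rightarrow> real" where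
  "column_seminorm P t g = sqrt (norm (P t (abs_sq g)))"

lemma positive_op_diffI:
  assumes "positive_op a" "positive_op b"
    and "\<And>x. inner x (blinfun_apply a x) \<le> inner x (blinfun_apply b x)"
  shows "positive_op (b - a)"
  using assms
  by (auto simp: positive_op_def complex_nonneg_Reals_iff blinfun.diff_left cinner_diff_right
      inner_eq_Re_cinner)

lemma norm_positive_op_mono:
  assumes "positive_op a" "a \<in> bounded_ops"
    and "\<And>x. inner x (blinfun_apply a x) \<le> inner x (blinfun_apply b x)"
  shows "norm a \<le> norm b"
proof (rule norm_positive_op_le[OF assms(1,2)])
  show "inner x (blinfun_apply a x) \<le> norm b * (norm x)\<^sup>2" for x
    using assms(3) inner_le_norm_op by (rule order_trans)
qed simp

lemma weighted_square_sum_le: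
  fixes v w :: "'h::real_normed_vector" and A B :: real
  assumes "0 < A" "0 < B"
  shows "(norm (v + w))\<^sup>2 \<le> (1 + B / A) * (norm v)\<^sup>2 + (1 + A / B) * (norm w)\<^sup>2"
proof -
  define a b where "a = norm v" and "b = norm w"
  have "(norm (v + w))\<^sup>2 \<le> (a + b)\<^sup>2"
    by (simp add: a_def b_def norm_triangle_ineq power_mono)
  also have "\<dots> \<le> (1 + B / A) * a\<^sup>2 + (1 + A / B) * b\<^sup>2"
  proof -
    have "(1 + B / A) * a\<^sup>2 + (1 + A / B) * b\<^sup>2 - (a + b)\<^sup>2 = (B * a - A * b)\<^sup>2 / (A * B)"
      using assms by (simp add: field_simps power2_eq_square)
    moreover have "0 \<le> (B * a - A * b)\<^sup>2 / (A * B)"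
      using assms by simp
    ultimately show ?thesis by linarith
  qed
  finally show ?thesis by (simp add: a_def b_def)
qed

definition averaging :: "(real \<Rightarrow> 'h::chilbert_space op \<Rightarrow> 'h op) \<Rightarrow> real \<Rightarrow> 'h op \<Rightarrow> 'h op" where
  "averaging P t g = (1/2) *\<^sub>R (g + P t g)"

definition difference :: "(real \<Rightarrow> 'h::chilbert_space op \<Rightarrow> 'h op) \<Rightarrow> real \<Rightarrow> 'h op \<Rightarrow> 'h op" where
  "difference P t g = g - P t g"

context
  fixes M :: "'h::chilbert_space op set" and P :: "real \<Rightarrow> 'h op \<Rightarrow> 'h op"
  assumes vN: "von_neumann_algebra M"
    and schwarz: "\<And>t. 0 < t \<Longrightarrow> schwarz_map M (P t)"
    and law: "\<And>s t f. 0 < s \<Longrightarrow> 0 < t \<Longrightarrow> f \<in> M \<Longrightarrow> P s (P t f) = P (s + t) f"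
begin

lemma P_in: "0 < t \<Longrightarrow> f \<in> M \<Longrightarrow> P t f \<in> M"
  by (rule schwarz_in[OF vN schwarz])

lemma P_add: "0 < t \<Longrightarrow> f \<in> M \<Longrightarrow> g \<in> M \<Longrightarrow> P t (f + g) = P t f + P t g"
  by (rule schwarz_add[OF vN schwarz])

lemma P_diff: "0 < t \<Longrightarrow> f \<in> M \<Longrightarrow> g \<in> M \<Longrightarrow> P t (f - g) = P t f - P t g"
  by (rule schwarz_diff[OF vN schwarz])

lemma P_scaleR: "0 < t \<Longrightarrow> f \<in> M \<Longrightarrow> P t (r *\<^sub>R f) = r *\<^sub>R P t f"
  by (rule schwarz_scaleR[OF vN schwarz])

lemma P_abs_sq:
  assumes "0 < t" "g \<in> M"
  shows "P t (abs_sq g) \<in> M" "positive_op (P t (abs_sq g))" "P t (abs_sq g) \<in> bounded_ops"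
  using schwarz_pos[OF vN schwarz[OF assms(1)] vN_abs_sq[OF vN assms(2)]
      positive_op_abs_sq[OF vN_bounded[OF vN assms(2)]]]
    P_in[OF assms(1) vN_abs_sq[OF vN assms(2)]] vN_bounded[OF vN]
  by blast+

lemma column_seminorm_nonneg: "0 \<le> column_seminorm P t g"
  by (simp add: column_seminorm_def)

lemma column_seminorm_leI:
  assumes "0 < t" "g \<in> M" "0 \<le> c"
    and "\<And>x. inner x (blinfun_apply (P t (abs_sq g)) x) \<le> c\<^sup>2 * (norm x)\<^sup>2"
  shows "column_seminorm P t g \<le> c"
proof -
  have "norm (P t (abs_sq g)) \<le> c\<^sup>2"
    by (rule norm_positive_op_le[OF P_abs_sq(2,3)[OF assms(1,2)]]) (use assms in auto)
  then show ?thesis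
    unfolding column_seminorm_def using assms(3) by (intro real_le_lsqrt) auto
qed

lemma inner_le_column_seminorm:
  "inner x (blinfun_apply (P t (abs_sq g)) x) \<le> (column_seminorm P t g)\<^sup>2 * (norm x)\<^sup>2"
  using inner_le_norm_op by (simp add: column_seminorm_def)

text \<open>The inequality \<open>|g + h|\<^sup>2 \<le> (1 + B/A) |g|\<^sup>2 + (1 + A/B) |h|\<^sup>2\<close> holds as an inequality of operators and is
  preserved by \<open>P t\<close>. If \<open>A\<close> and \<open>B\<close> are the two seminorms, the right-hand side adds up to \<open>(A + B)\<^sup>2\<close>;
  a small \<open>e\<close> keeps the weights finite when a seminorm vanishes.\<close>

lemma column_seminorm_triangle:
  assumes t: "0 < t" and g: "g \<in> M" and h: "h \<in> M"
  shows "column_seminorm P t (g + h) \<le> column_seminorm P t g + column_seminorm P t h"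
proof (rule field_le_epsilon)
  fix e :: real assume "0 < e"
  define A B where "A = column_seminorm P t g + e / 2" and "B = column_seminorm P t h + e / 2"
  have pos: "0 < A" "0 < B"
    using \<open>0 < e\<close> column_seminorm_nonneg by (auto simp: A_def B_def add_nonneg_pos)
  define Q where "Q = (1 + B / A) *\<^sub>R abs_sq g + (1 + A / B) *\<^sub>R abs_sq h"
  have b: "g \<in> bounded_ops" "h \<in> bounded_ops" "g + h \<in> bounded_ops"
    using g h vN_bounded[OF vN] vN_add[OF vN] by auto
  have QM: "Q \<in> M"
    unfolding Q_def by (intro vN_add[OF vN] vN_scaleR[OF vN] vN_abs_sq[OF vN] g h)
  have dom: "positive_op (Q - abs_sq (g + h))"
  proof (rule positive_op_diffI[OF positive_op_abs_sq[OF b(3)]])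
    show "positive_op Q"
      using pos
      by (auto simp: positive_op_def Q_def blinfun.add_left blinfun.scaleR_left cinner_add_right
          cinner_scaleR_right cinner_abs_sq[OF b(1)] cinner_abs_sq[OF b(2)] cinner_self
          complex_nonneg_Reals_iff)
    show "inner x (blinfun_apply (abs_sq (g + h)) x) \<le> inner x (blinfun_apply Q x)" for x
      using weighted_square_sum_le[OF pos, of "blinfun_apply g x" "blinfun_apply h x"]
      by (simp add: Q_def inner_abs_sq[OF b(3)] blinfun.add_left blinfun.scaleR_left inner_add_right
          inner_abs_sq[OF b(1)] inner_abs_sq[OF b(2)])
  qed
  have "column_seminorm P t (g + h) \<le> A + B"
  proof (rule column_seminorm_leI[OF t vN_add[OF vN g h]])
    fix x
    have "inner x (blinfun_apply (P t (abs_sq (g + h))) x) \<le> inner x (blinfun_apply (P t Q) x)"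
      by (rule schwarz_mono[OF vN schwarz[OF t] vN_abs_sq[OF vN vN_add[OF vN g h]] QM dom])
    also have "\<dots> = (1 + B / A) * inner x (blinfun_apply (P t (abs_sq g)) x)
        + (1 + A / B) * inner x (blinfun_apply (P t (abs_sq h)) x)"
      by (simp add: Q_def P_add[OF t] P_scaleR[OF t] vN_scaleR[OF vN] vN_abs_sq[OF vN] g h
          blinfun.add_left blinfun.scaleR_left inner_add_right)
    also have "\<dots> \<le> (1 + B / A) * (A\<^sup>2 * (norm x)\<^sup>2) + (1 + A / B) * (B\<^sup>2 * (norm x)\<^sup>2)"
    proof (intro add_mono mult_left_mono)
      show "inner x (blinfun_apply (P t (abs_sq g)) x) \<le> A\<^sup>2 * (norm x)\<^sup>2"
        using \<open>0 < e\<close> column_seminorm_nonneg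
        by (intro order_trans[OF inner_le_column_seminorm] mult_right_mono power_mono) (auto simp: A_def)
      show "inner x (blinfun_apply (P t (abs_sq h)) x) \<le> B\<^sup>2 * (norm x)\<^sup>2"
        using \<open>0 < e\<close> column_seminorm_nonneg
        by (intro order_trans[OF inner_le_column_seminorm] mult_right_mono power_mono) (auto simp: B_def)
    qed (use pos in auto)
    also have "\<dots> = (A + B)\<^sup>2 * (norm x)\<^sup>2"
      using pos by (simp add: field_simps power2_eq_square)
    finally show "inner x (blinfun_apply (P t (abs_sq (g + h))) x) \<le> (A + B)\<^sup>2 * (norm x)\<^sup>2" .
  qed (use pos in simp)
  then show "column_seminorm P t (g + h) \<le> column_seminorm P t g + column_seminorm P t h + e"
    by (simp add: A_def B_def)
qed

lemma abs_sq_scaleR: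
  assumes "g \<in> M"
  shows "abs_sq (r *\<^sub>R g) = r\<^sup>2 *\<^sub>R abs_sq g"
proof (rule blinfun_eqI, rule vector_eqI)
  fix x y :: 'h
  have b: "g \<in> bounded_ops" "r *\<^sub>R g \<in> bounded_ops"
    using assms vN_bounded[OF vN] vN_scaleR[OF vN] by auto
  have form: "inner x (blinfun_apply (abs_sq a) y) = inner (blinfun_apply a x) (blinfun_apply a y)"
    if "a \<in> bounded_ops" for a :: "'h op"
    by (simp add: inner_eq_Re_cinner cinner_abs_sq[OF that])
  show "inner x (blinfun_apply (abs_sq (r *\<^sub>R g)) y) = inner x (blinfun_apply (r\<^sup>2 *\<^sub>R abs_sq g) y)"
    unfolding form[OF b(2)]
    by (simp add: blinfun.scaleR_left form[OF b(1)] power2_eq_square)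
qed

lemma column_seminorm_scaleR:
  assumes "0 < t" "g \<in> M"
  shows "column_seminorm P t (r *\<^sub>R g) = \<bar>r\<bar> * column_seminorm P t g"
  using assms
  by (simp add: column_seminorm_def abs_sq_scaleR P_scaleR vN_abs_sq[OF vN] real_sqrt_mult)

lemma column_seminorm_le_norm:
  assumes "0 < t" "g \<in> M"
  shows "column_seminorm P t g \<le> norm g"
proof -
  have b: "g \<in> bounded_ops" "abs_sq g \<in> M" "abs_sq g \<in> bounded_ops"
    using assms vN vN_abs_sq vN_bounded by blast+
  have "norm (P t (abs_sq g)) \<le> norm (abs_sq g)"
    by (rule schwarz_contraction[OF vN schwarz[OF assms(1)] b(2)])
  also have "\<dots> \<le> (norm g)\<^sup>2"
    by (rule norm_abs_sq[OF b(1,3)])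
  finally show ?thesis
    unfolding column_seminorm_def by (simp add: real_le_lsqrt)
qed

text \<open>The Schwarz inequality for \<open>P t\<close> inside \<open>P s\<close>, followed by the semigroup law.\<close>

lemma column_seminorm_P_le:
  assumes s: "0 < s" and t: "0 < t" and g: "g \<in> M"
  shows "column_seminorm P s (P t g) \<le> column_seminorm P (s + t) g"
  unfolding column_seminorm_def
proof (intro real_sqrt_le_mono norm_positive_op_mono)
  have gt: "P t g \<in> M" by (rule P_in[OF t g])
  show "positive_op (P s (abs_sq (P t g)))" "P s (abs_sq (P t g)) \<in> bounded_ops"
    by (rule P_abs_sq[OF s gt])+
  fix x
  have "positive_op (P t (abs_sq g) - abs_sq (P t g))"
    using schwarz_norm_sq_le[OF vN schwarz[OF t] g] inner_abs_sq[OF vN_bounded[OF vN gt]]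
    by (intro positive_op_diffI P_abs_sq(2)[OF t g] positive_op_abs_sq vN_bounded[OF vN gt]) simp
  from schwarz_mono[OF vN schwarz[OF s] vN_abs_sq[OF vN gt] P_abs_sq(1)[OF t g] this, of x]
  show "inner x (blinfun_apply (P s (abs_sq (P t g))) x) \<le> inner x (blinfun_apply (P (s + t) (abs_sq g)) x)"
    by (simp add: law[OF s t] vN_abs_sq[OF vN g])
qed

text \<open>Here the semigroup law is followed by contractivity.\<close>

lemma column_seminorm_antimono:
  assumes s: "0 < s" and t: "0 < t" and g: "g \<in> M"
  shows "column_seminorm P (s + t) g \<le> column_seminorm P s g"
proof -
  have "norm (P t (P s (abs_sq g))) \<le> norm (P s (abs_sq g))"
    by (rule schwarz_contraction[OF vN schwarz[OF t] P_abs_sq(1)[OF s g]])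
  then show ?thesis
    by (simp add: column_seminorm_def law[OF t s] vN_abs_sq[OF vN g] add.commute)
qed

lemma column_seminorm_P_contract:
  assumes "0 < s" "0 < t" "g \<in> M"
  shows "column_seminorm P s (P t g) \<le> column_seminorm P s g"
  using column_seminorm_P_le[OF assms] column_seminorm_antimono[OF assms] by linarith

lemma difference_in: "0 < t \<Longrightarrow> g \<in> M \<Longrightarrow> difference P t g \<in> M"
  by (simp add: difference_def vN_diff[OF vN] P_in)

lemma averaging_in: "0 < t \<Longrightarrow> g \<in> M \<Longrightarrow> averaging P t g \<in> M"
  by (simp add: averaging_def vN_add[OF vN] vN_scaleR[OF vN] P_in)

lemma difference_pow_in: "0 < t \<Longrightarrow> g \<in> M \<Longrightarrow> (difference P t ^^ k) g \<in> M"
  by (induction k) (auto intro: difference_in)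

lemma averaging_pow_in: "0 < t \<Longrightarrow> g \<in> M \<Longrightarrow> (averaging P t ^^ k) g \<in> M"
  by (induction k) (auto intro: averaging_in)

lemma difference_averaging:
  assumes "0 < t" "g \<in> M"
  shows "difference P t (averaging P t g) = averaging P t (difference P t g)"
  using assms
  by (simp add: difference_def averaging_def P_scaleR P_add P_diff P_in vN_add[OF vN] vN_diff[OF vN]
      vN_scaleR[OF vN] scaleR_add_right scaleR_diff_right)

lemma difference_scaleR:
  assumes "0 < t" "g \<in> M"
  shows "difference P t (r *\<^sub>R g) = r *\<^sub>R difference P t g"
  using assms by (simp add: difference_def P_scaleR scaleR_diff_right)

text \<open>\<open>1 - P\<^sup>2 = (1 - P) (1 + P)\<close>.\<close>

lemma difference_double:
  assumes "0 < t" "g \<in> M"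
  shows "difference P (2 * t) g = 2 *\<^sub>R difference P t (averaging P t g)"
  using assms law[OF assms(1) assms(1) assms(2)]
  by (simp add: difference_def averaging_def P_scaleR P_add P_in vN_add[OF vN] vN_scaleR[OF vN]
      scaleR_diff_right scaleR_add_right)

lemma averaging_pow_difference_pow:
  assumes "0 < t" "g \<in> M"
  shows "(averaging P t ^^ j) ((difference P t ^^ k) g) = (difference P t ^^ k) ((averaging P t ^^ j) g)"
proof -
  have one: "(averaging P t ^^ j) (difference P t h) = difference P t ((averaging P t ^^ j) h)" if "h \<in> M" for h
    by (induction j) (simp_all add: difference_averaging assms(1) averaging_pow_in that)
  show ?thesis
    by (induction k) (simp_all add: one difference_pow_in assms)
qed

lemma difference_pow_double:
  assumes "0 < t" "g \<in> M"
  shows "(difference P (2 * t) ^^ k) g = 2 ^ k *\<^sub>R (averaging P t ^^ k) ((difference P t ^^ k) g)"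
proof (induction k)
  case (Suc k)
  let ?D = "difference P t" and ?U = "averaging P t"
  let ?h = "(?U ^^ k) ((?D ^^ k) g)"
  have h: "?h \<in> M" using assms by (intro averaging_pow_in difference_pow_in)
  have "(difference P (2 * t) ^^ Suc k) g = 2 ^ k *\<^sub>R difference P (2 * t) ?h"
    using assms h by (simp add: Suc difference_scaleR)
  also have "\<dots> = 2 ^ Suc k *\<^sub>R ?D (?U ?h)"
    unfolding difference_double[OF assms(1) h] by (simp add: mult.commute)
  also have "?D (?U ?h) = ?U ((?U ^^ k) (?D ((?D ^^ k) g)))"
    using difference_averaging[OF assms(1) h]
      averaging_pow_difference_pow[OF assms(1) difference_pow_in[OF assms, of k], of k 1] by simp
  finally show ?case by simp
qed simp

lemma column_seminorm_averaging:
  assumes s: "0 < s" and t: "0 < t" and g: "g \<in> M"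
  shows "column_seminorm P s (averaging P t g) \<le> column_seminorm P s g"
proof -
  have "column_seminorm P s (averaging P t g) = 1/2 * column_seminorm P s (g + P t g)"
    unfolding averaging_def by (subst column_seminorm_scaleR) (auto intro: assms vN_add[OF vN] P_in)
  also have "\<dots> \<le> 1/2 * (column_seminorm P s g + column_seminorm P s g)"
    using column_seminorm_triangle[OF s g P_in[OF t g]] column_seminorm_P_contract[OF assms] by simp
  finally show ?thesis by simp
qed

lemma column_seminorm_averaging_pow:
  assumes "0 < s" "0 < t" "g \<in> M"
  shows "column_seminorm P s ((averaging P t ^^ j) g) \<le> column_seminorm P s g"
proof (induction j)
  case (Suc j)
  then show ?case
    using column_seminorm_averaging[OF assms(1,2) averaging_pow_in[OF assms(2,3), of j]]
    by simp
qed simp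

text \<open>\<open>g = U g + D g / 2\<close>.\<close>

lemma column_seminorm_averaging_step:
  assumes s: "0 < s" and t: "0 < t" and g: "g \<in> M"
  shows "column_seminorm P s g \<le> column_seminorm P s (averaging P t g) + 1/2 * column_seminorm P s (difference P t g)"
proof -
  have "g + P t g + (g - P t g) = 2 *\<^sub>R g"
    by (simp add: scaleR_2)
  then have "g = averaging P t g + (1/2) *\<^sub>R difference P t g"
    unfolding averaging_def difference_def scaleR_add_right[symmetric] by simp
  then have "column_seminorm P s g \<le> column_seminorm P s (averaging P t g) + column_seminorm P s ((1/2) *\<^sub>R difference P t g)"
    using column_seminorm_triangle[OF s averaging_in[OF t g] vN_scaleR[OF vN difference_in[OF t g], of "1/2"]]
    by simp
  then show ?thesis
    using column_seminorm_scaleR[OF s difference_in[OF t g], of "1/2"] by simp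
qed

lemma column_seminorm_le_averaging_pow:
  assumes "0 < s" "0 < t" "g \<in> M"
  shows "column_seminorm P s g
    \<le> column_seminorm P s ((averaging P t ^^ j) g) + real j / 2 * column_seminorm P s (difference P t g)"
proof (induction j)
  case (Suc j)
  let ?U = "averaging P t" and ?p = "column_seminorm P s"
  have "?p ((?U ^^ j) g) \<le> ?p (?U ((?U ^^ j) g)) + 1/2 * ?p (difference P t ((?U ^^ j) g))"
    by (rule column_seminorm_averaging_step[OF assms(1,2) averaging_pow_in[OF assms(2,3)]])
  moreover have "?p (difference P t ((?U ^^ j) g)) \<le> ?p (difference P t g)"
    using averaging_pow_difference_pow[OF assms(2,3), of j 1]
      column_seminorm_averaging_pow[OF assms(1,2) difference_in[OF assms(2,3)], of j] by simp
  ultimately show ?case using Suc.IH by (simp add: field_simps)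
qed simp

lemma column_seminorm_difference_le:
  assumes s: "0 < s" and t: "0 < t" and g: "g \<in> M"
  shows "column_seminorm P s (difference P t g) \<le> 2 * column_seminorm P s g"
proof -
  have "column_seminorm P s (difference P t g) = column_seminorm P s (g + (-1) *\<^sub>R P t g)"
    by (simp add: difference_def)
  also have "\<dots> \<le> column_seminorm P s g + column_seminorm P s ((-1) *\<^sub>R P t g)"
    by (rule column_seminorm_triangle[OF s g vN_scaleR[OF vN P_in[OF t g]]])
  also have "column_seminorm P s ((-1) *\<^sub>R P t g) = column_seminorm P s (P t g)"
    by (subst column_seminorm_scaleR[OF s P_in[OF t g]]) simp
  also have "\<dots> \<le> column_seminorm P s g"
    by (rule column_seminorm_P_contract[OF assms])
  finally show ?thesis by simp
qed

lemma column_seminorm_difference_pow_bounded: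
  assumes "0 < t" "g \<in> M"
  shows "column_seminorm P t ((difference P t ^^ k) g) \<le> 2 ^ k * norm g"
proof (induction k)
  case 0
  then show ?case using column_seminorm_le_norm[OF assms] by simp
next
  case (Suc k)
  then show ?case
    using column_seminorm_difference_le[OF assms(1,1) difference_pow_in[OF assms, of k]] by simp
qed

text \<open>The key estimate. One difference pays for the passage from \<open>p\<^sub>t\<close> to \<open>p\<^sub>2\<^sub>t\<close>, and \<open>k\<close> half
  differences pay for the \<open>k\<close> averages that convert \<open>D\<^sub>t\<^sup>k\<close> into \<open>2\<^sup>-\<^sup>k D\<^sub>2\<^sub>t\<^sup>k\<close>. It is the gain \<open>2\<^sup>-\<^sup>k\<close> that
  beats the growth \<open>2\<^sup>\<alpha>\<close> of \<open>t\<^sup>\<alpha>\<close> under doubling.\<close>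

lemma column_seminorm_doubling:
  assumes t: "0 < t" and f: "f \<in> M"
  shows "column_seminorm P t ((difference P t ^^ k) f)
    \<le> (1/2) ^ k * column_seminorm P (2 * t) ((difference P (2 * t) ^^ k) f)
      + (1 + real k / 2) * column_seminorm P t ((difference P t ^^ Suc k) f)"
proof -
  let ?D = "difference P t" and ?U = "averaging P t"
  let ?g = "(?D ^^ k) f"
  have g: "?g \<in> M" by (rule difference_pow_in[OF t f])
  have tt: "0 < 2 * t" using t by simp
  have "column_seminorm P t ?g = column_seminorm P t (P t ?g + ?D ?g)"
    by (simp add: difference_def)
  also have "\<dots> \<le> column_seminorm P t (P t ?g) + column_seminorm P t (?D ?g)"
    by (rule column_seminorm_triangle[OF t P_in[OF t g] difference_in[OF t g]])
  finally have 1: "column_seminorm P t ?g \<le> column_seminorm P (2 * t) ?g + column_seminorm P t (?D ?g)"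
    using column_seminorm_P_le[OF t t g] by simp
  have "column_seminorm P (2 * t) ?g
      \<le> column_seminorm P (2 * t) ((?U ^^ k) ?g) + real k / 2 * column_seminorm P (2 * t) (?D ?g)"
    by (rule column_seminorm_le_averaging_pow[OF tt t g])
  also have "column_seminorm P (2 * t) ((?U ^^ k) ?g)
      = (1/2) ^ k * column_seminorm P (2 * t) ((difference P (2 * t) ^^ k) f)"
    by (simp add: difference_pow_double[OF t f] column_seminorm_scaleR[OF tt averaging_pow_in[OF t g]]
        power_one_over)
  finally have 2: "column_seminorm P (2 * t) ?g
      \<le> (1/2) ^ k * column_seminorm P (2 * t) ((difference P (2 * t) ^^ k) f)
        + real k / 2 * column_seminorm P (2 * t) (?D ?g)" .
  have "real k / 2 * column_seminorm P (2 * t) (?D ?g) \<le> real k / 2 * column_seminorm P t (?D ?g)"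
    using column_seminorm_antimono[OF t t difference_in[OF t g]] by (intro mult_left_mono) simp_all
  with 1 2 show ?thesis
    by (simp add: distrib_right)
qed

end

section \<open>A dyadic recursion\<close>

text \<open>With \<open>\<theta> = q 2\<^sup>\<alpha>\<close>, the multiple \<open>X = L / (1 - \<theta>)\<close> is the fixed point of \<open>X \<mapsto> \<theta> X + L\<close>, so the bound
  \<open>X t\<^sup>\<alpha>\<close> reproduces itself; the error made by starting from \<open>K\<close> is multiplied by \<open>q\<close> in each step.\<close>

lemma dyadic_recursion_bound:
  fixes a :: "real \<Rightarrow> real"
  assumes rec: "\<And>t. 0 < t \<Longrightarrow> a t \<le> q * a (2 * t) + L * t powr \<alpha>"
    and bound: "\<And>t. 0 < t \<Longrightarrow> a t \<le> K"
    and q: "0 \<le> q" "q < 1" "q * 2 powr \<alpha> < 1" and L: "0 \<le> L" and t: "0 < t"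
  shows "a t \<le> L / (1 - q * 2 powr \<alpha>) * t powr \<alpha>"
proof -
  define \<theta> where "\<theta> = q * 2 powr \<alpha>"
  define X where "X = L / (1 - \<theta>)"
  have \<theta>: "0 \<le> \<theta>" "\<theta> < 1" using q by (auto simp: \<theta>_def)
  have X: "\<theta> * X + L = X" using \<theta> by (simp add: X_def field_simps)
  have iter: "a t \<le> q ^ n * K + X * t powr \<alpha>" if "0 < t" for n t
    using that
  proof (induction n arbitrary: t)
    case 0
    have "0 \<le> X * t powr \<alpha>" using \<theta> L by (simp add: X_def)
    then show ?case using bound[OF 0] by simp
  next
    case (Suc n)
    have "a t \<le> q * a (2 * t) + L * t powr \<alpha>" by (rule rec[OF Suc.prems])
    also have "q * a (2 * t) \<le> q * (q ^ n * K + X * (2 * t) powr \<alpha>)"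
      using Suc.IH[of "2 * t"] Suc.prems q(1) by (intro mult_left_mono) auto
    also have "q * (q ^ n * K + X * (2 * t) powr \<alpha>) + L * t powr \<alpha> = q ^ Suc n * K + (\<theta> * X + L) * t powr \<alpha>"
      using Suc.prems by (simp add: powr_mult \<theta>_def algebra_simps)
    finally show ?case by (simp add: X)
  qed
  have "(\<lambda>n. q ^ n * K + X * t powr \<alpha>) \<longlonglongrightarrow> 0 * K + X * t powr \<alpha>"
    using q by (intro tendsto_intros LIMSEQ_power_zero) auto
  then have "a t \<le> 0 * K + X * t powr \<alpha>"
    by (rule LIMSEQ_le_const) (use iter[OF t] in blast)
  then show ?thesis by (simp add: X_def \<theta>_def)
qed

section \<open>Comparison of the Lipschitz norms\<close>

lemma lip_norm_column:
  "lip_norm P \<alpha> k f = ennreal (norm f) +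
     (SUP t\<in>{0<..}. ennreal (column_seminorm P t ((difference P t ^^ k) f) / t powr \<alpha>))"
proof -
  have "difference P t = (\<lambda>g. g - P t g)" for t
    by (simp add: fun_eq_iff difference_def)
  then show ?thesis
    by (simp add: lip_norm_def column_seminorm_def)
qed

lemma lip_norm_leI:
  assumes "0 \<le> N" and "\<And>t. 0 < t \<Longrightarrow> column_seminorm P t ((difference P t ^^ k) f) \<le> N * t powr \<alpha>"
  shows "lip_norm P \<alpha> k f \<le> ennreal (norm f + N)"
proof -
  have "(SUP t\<in>{0<..}. ennreal (column_seminorm P t ((difference P t ^^ k) f) / t powr \<alpha>)) \<le> ennreal N"
    using assms by (intro SUP_least ennreal_leI) (simp add: pos_divide_le_eq)
  then show ?thesis
    unfolding lip_norm_column using assms(1) by (simp add: ennreal_plus add_left_mono)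
qed

lemma lip_norm_finiteE:
  assumes "lip_norm P \<alpha> k f < \<infinity>"
  obtains N where "0 \<le> N" "lip_norm P \<alpha> k f = ennreal (norm f + N)"
    "\<And>t. 0 < t \<Longrightarrow> column_seminorm P t ((difference P t ^^ k) f) \<le> N * t powr \<alpha>"
proof -
  define S where "S = (SUP t\<in>{0<..}. ennreal (column_seminorm P t ((difference P t ^^ k) f) / t powr \<alpha>))"
  have "S < \<infinity>"
    using assms unfolding lip_norm_column S_def[symmetric] by simp
  then obtain N where N: "0 \<le> N" "S = ennreal N"
    by (cases S) auto
  show ?thesis
  proof
    show "0 \<le> N" by (rule N(1))
    show "lip_norm P \<alpha> k f = ennreal (norm f + N)"
      unfolding lip_norm_column S_def[symmetric] N(2) using N(1) by (simp add: ennreal_plus)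
    show "column_seminorm P t ((difference P t ^^ k) f) \<le> N * t powr \<alpha>" if t: "0 < t" for t
    proof -
      have "ennreal (column_seminorm P t ((difference P t ^^ k) f) / t powr \<alpha>) \<le> ennreal N"
        unfolding N(2)[symmetric] S_def using t by (intro SUP_upper) simp
      then have "column_seminorm P t ((difference P t ^^ k) f) / t powr \<alpha> \<le> N"
        using N(1) by simp
      then show ?thesis using t by (simp add: pos_divide_le_eq)
    qed
  qed
qed

context
  fixes M :: "'h::chilbert_space op set" and P :: "real \<Rightarrow> 'h op \<Rightarrow> 'h op"
  assumes vN: "von_neumann_algebra M"
    and schwarz: "\<And>t. 0 < t \<Longrightarrow> schwarz_map M (P t)"
    and law: "\<And>s t f. 0 < s \<Longrightarrow> 0 < t \<Longrightarrow> f \<in> M \<Longrightarrow> P s (P t f) = P (s + t) f"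
begin

lemma lip_norm_Suc_le:
  assumes f: "f \<in> M"
  shows "lip_norm P \<alpha> (Suc k) f \<le> ennreal 2 * lip_norm P \<alpha> k f"
proof (cases "lip_norm P \<alpha> k f < \<infinity>")
  case True
  then obtain N where N: "0 \<le> N" "lip_norm P \<alpha> k f = ennreal (norm f + N)"
    "\<And>t. 0 < t \<Longrightarrow> column_seminorm P t ((difference P t ^^ k) f) \<le> N * t powr \<alpha>"
    using lip_norm_finiteE by blast
  have "lip_norm P \<alpha> (Suc k) f \<le> ennreal (norm f + 2 * N)"
  proof (rule lip_norm_leI)
    fix t :: real assume t: "0 < t"
    show "column_seminorm P t ((difference P t ^^ Suc k) f) \<le> 2 * N * t powr \<alpha>"
      using column_seminorm_difference_le[OF vN schwarz law t t difference_pow_in[OF vN schwarz law t f, of k]]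
        N(3)[OF t] by simp
  qed (use N in simp)
  also have "\<dots> \<le> ennreal (2 * (norm f + N))"
    by (rule ennreal_leI) simp
  also have "\<dots> = ennreal 2 * lip_norm P \<alpha> k f"
    unfolding N(2) by (rule ennreal_mult) (use N in auto)
  finally show ?thesis .
next
  case False
  then have "lip_norm P \<alpha> k f = top" by (metis infinity_ennreal_def less_top)
  then show ?thesis by (simp add: ennreal_mult_top)
qed

text \<open>Iterate \<open>column_seminorm_doubling\<close>; the ratio of the geometric series is \<open>2\<^sup>\<alpha>\<^sup>-\<^sup>k\<close>.\<close>

lemma lip_norm_le_Suc:
  assumes \<alpha>: "0 < \<alpha>" "\<alpha> < real k"
  obtains C where "1 \<le> C" "\<And>f. f \<in> M \<Longrightarrow> lip_norm P \<alpha> k f \<le> ennreal C * lip_norm P \<alpha> (Suc k) f"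
proof -
  define q where "q = (1/2 :: real) ^ k"
  have "q * 2 powr \<alpha> = 2 powr (\<alpha> - real k)"
    by (simp add: q_def powr_diff powr_realpow power_one_over)
  also have "\<dots> < 1"
    using \<alpha> by (simp add: powr_less_one)
  finally have q: "q * 2 powr \<alpha> < 1" .
  have q01: "0 \<le> q" "q < 1"
    using \<alpha> by (auto simp: q_def power_less_one_iff)
  \<comment> \<open>The summand \<open>1\<close> absorbs the term \<open>norm f\<close>, which both norms contain.\<close>
  define C where "C = 1 + (1 + real k / 2) / (1 - q * 2 powr \<alpha>)"
  have C: "1 \<le> C" using q by (simp add: C_def)
  moreover have "lip_norm P \<alpha> k f \<le> ennreal C * lip_norm P \<alpha> (Suc k) f" if f: "f \<in> M" for f
  proof (cases "lip_norm P \<alpha> (Suc k) f < \<infinity>")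
    case True
    then obtain N where N: "0 \<le> N" "lip_norm P \<alpha> (Suc k) f = ennreal (norm f + N)"
      "\<And>t. 0 < t \<Longrightarrow> column_seminorm P t ((difference P t ^^ Suc k) f) \<le> N * t powr \<alpha>"
      using lip_norm_finiteE by blast
    let ?L = "(1 + real k / 2) * N"
    have "lip_norm P \<alpha> k f \<le> ennreal (norm f + ?L / (1 - q * 2 powr \<alpha>))"
    proof (rule lip_norm_leI)
      fix t :: real assume t: "0 < t"
      show "column_seminorm P t ((difference P t ^^ k) f) \<le> ?L / (1 - q * 2 powr \<alpha>) * t powr \<alpha>"
      proof (rule dyadic_recursion_bound[OF _ _ q01 q _ t])
        fix s :: real assume s: "0 < s"
        have "(1 + real k / 2) * column_seminorm P s ((difference P s ^^ Suc k) f)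
            \<le> (1 + real k / 2) * (N * s powr \<alpha>)"
          by (rule mult_left_mono[OF N(3)[OF s]]) simp
        then show "column_seminorm P s ((difference P s ^^ k) f)
            \<le> q * column_seminorm P (2 * s) ((difference P (2 * s) ^^ k) f) + ?L * s powr \<alpha>"
          using column_seminorm_doubling[OF vN schwarz law s f, of k]
          unfolding q_def mult.assoc by linarith
        show "column_seminorm P s ((difference P s ^^ k) f) \<le> 2 ^ k * norm f"
          by (rule column_seminorm_difference_pow_bounded[OF vN schwarz law s f])
      qed (use N in simp)
    qed (use N q in simp)
    also have "?L / (1 - q * 2 powr \<alpha>) = (C - 1) * N"
      by (simp add: C_def)
    also have "ennreal (norm f + (C - 1) * N) \<le> ennreal (C * (norm f + N))"
    proof (rule ennreal_leI)
      have "norm f \<le> C * norm f" using C mult_right_mono[of 1 C "norm f"] by simp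
      then show "norm f + (C - 1) * N \<le> C * (norm f + N)"
        using N(1) by (simp add: algebra_simps)
    qed
    also have "\<dots> = ennreal C * lip_norm P \<alpha> (Suc k) f"
      unfolding N(2) by (rule ennreal_mult) (use N C in auto)
    finally show ?thesis .
  next
    case False
    then have "lip_norm P \<alpha> (Suc k) f = top" by (metis infinity_ennreal_def less_top)
    then show ?thesis using C by (simp add: ennreal_mult_top)
  qed
  ultimately show ?thesis using that by blast
qed

lemma lip_norm_equiv:
  assumes \<alpha>: "0 < \<alpha>" "\<alpha> < real k"
  obtains C where "1 \<le> C"
    "\<And>f. f \<in> M \<Longrightarrow> lip_norm P \<alpha> k f \<le> ennreal C * lip_norm P \<alpha> (k + n) f"
    "\<And>f. f \<in> M \<Longrightarrow> lip_norm P \<alpha> (k + n) f \<le> ennreal (2 ^ n) * lip_norm P \<alpha> k f"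
proof -
  have "\<exists>C\<ge>1. \<forall>f\<in>M. lip_norm P \<alpha> k f \<le> ennreal C * lip_norm P \<alpha> (k + n) f"
  proof (induction n)
    case 0
    show ?case by (intro exI[of _ 1]) simp
  next
    case (Suc n)
    then obtain C where C: "1 \<le> C" "\<And>f. f \<in> M \<Longrightarrow> lip_norm P \<alpha> k f \<le> ennreal C * lip_norm P \<alpha> (k + n) f"
      by blast
    have "\<alpha> < real (k + n)" using \<alpha>(2) by simp
    from lip_norm_le_Suc[OF \<alpha>(1) this] obtain C' where
      C': "1 \<le> C'" "\<And>f. f \<in> M \<Longrightarrow> lip_norm P \<alpha> (k + n) f \<le> ennreal C' * lip_norm P \<alpha> (Suc (k + n)) f"
      by blast
    have "lip_norm P \<alpha> k f \<le> ennreal (C * C') * lip_norm P \<alpha> (k + Suc n) f" if "f \<in> M" for f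
    proof -
      have "lip_norm P \<alpha> k f \<le> ennreal C * (ennreal C' * lip_norm P \<alpha> (Suc (k + n)) f)"
        using C(2)[OF that] mult_left_mono[OF C'(2)[OF that], of "ennreal C"] by simp
      then show ?thesis
        using C(1) C'(1) by (simp add: ennreal_mult mult.assoc)
    qed
    moreover have "1 \<le> C * C'" using C(1) C'(1) mult_mono[of 1 C 1 C'] by simp
    ultimately show ?case by blast
  qed
  moreover have "lip_norm P \<alpha> (k + n) f \<le> ennreal (2 ^ n) * lip_norm P \<alpha> k f" if "f \<in> M" for f
  proof (induction n)
    case (Suc n)
    have "lip_norm P \<alpha> (k + Suc n) f \<le> ennreal 2 * lip_norm P \<alpha> (k + n) f"
      using lip_norm_Suc_le[OF that, of \<alpha> "k + n"] by simp
    also have "\<dots> \<le> ennreal 2 * (ennreal (2 ^ n) * lip_norm P \<alpha> k f)"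
      by (rule mult_left_mono[OF Suc.IH]) simp
    also have "\<dots> = ennreal (2 ^ Suc n) * lip_norm P \<alpha> k f"
      by (simp add: ennreal_mult mult.assoc)
    finally show ?case .
  qed simp
  ultimately show ?thesis using that by blast
qed

end

theorem theorem1p3:
  fixes M :: "'h::chilbert_space op set"
    and \<tau> :: "'h op \<Rightarrow> complex"
    and T :: "real \<Rightarrow> 'h op \<Rightarrow> 'h op"
    and \<alpha> \<alpha>\<^sub>0 :: real
    and k :: nat
  assumes "von_neumann_algebra M"
    and "normal_faithful_finite_trace M \<tau>"
    and "markov_semigroup M \<tau> T"
    and "2 powr (\<alpha>\<^sub>0 - 2) + 3 powr (\<alpha>\<^sub>0 - 3) = 1"
    and "0 < \<alpha>" and "\<alpha> < \<alpha>\<^sub>0"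
    and "int k \<ge> \<lfloor>\<alpha>\<rfloor> + 1"
  shows "lip_space0 M (poisson_semigroup M T) \<alpha> = lip_space M (poisson_semigroup M T) \<alpha> k \<and>
    (\<exists>c C :: real. 0 < c \<and> 0 < C \<and>
      (\<forall>f \<in> lip_space0 M (poisson_semigroup M T) \<alpha>.
        ennreal c * lip_norm0 (poisson_semigroup M T) \<alpha> f \<le> lip_norm (poisson_semigroup M T) \<alpha> k f \<and>
        lip_norm (poisson_semigroup M T) \<alpha> k f \<le> ennreal C * lip_norm0 (poisson_semigroup M T) \<alpha> f))"
proof -
  let ?P = "poisson_semigroup M T"
  define k0 where "k0 = nat \<lfloor>\<alpha>\<rfloor> + 1"
  have floor: "0 \<le> \<lfloor>\<alpha>\<rfloor>" using assms(5) by simp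
  have \<alpha>: "\<alpha> < real k0" using floor by (simp add: k0_def) linarith
  have "k0 \<le> k" using assms(7) floor unfolding k0_def by linarith
  then obtain n where k: "k = k0 + n" using le_Suc_ex by blast
  obtain C where C: "1 \<le> C"
    and low: "\<And>f. f \<in> M \<Longrightarrow> lip_norm ?P \<alpha> k0 f \<le> ennreal C * lip_norm ?P \<alpha> k f"
    and up: "\<And>f. f \<in> M \<Longrightarrow> lip_norm ?P \<alpha> k f \<le> ennreal (2 ^ n) * lip_norm ?P \<alpha> k0 f"
    using lip_norm_equiv[OF assms(1) poisson_schwarz[OF assms(1,3)]
        poisson_semigroup_law[OF assms(1,3)] assms(5) \<alpha>, of n] unfolding k by blast
  have "lip_norm ?P \<alpha> k0 f < \<infinity> \<longleftrightarrow> lip_norm ?P \<alpha> k f < \<infinity>" if "f \<in> M" for f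
    using low[OF that] up[OF that]
    by (auto simp: ennreal_mult_less_top elim!: order_le_less_trans)
  then have spaces: "lip_space0 M ?P \<alpha> = lip_space M ?P \<alpha> k"
    unfolding lip_space0_def lip_space_def k0_def[symmetric] by auto
  have "ennreal (1 / C) * lip_norm ?P \<alpha> k0 f \<le> lip_norm ?P \<alpha> k f" if "f \<in> M" for f
  proof -
    have "ennreal (1 / C) * lip_norm ?P \<alpha> k0 f \<le> ennreal (1 / C) * (ennreal C * lip_norm ?P \<alpha> k f)"
      by (rule mult_left_mono[OF low[OF that]]) simp
    also have "\<dots> = ennreal (1 / C) * ennreal C * lip_norm ?P \<alpha> k f"
      by (rule mult.assoc[symmetric])
    also have "ennreal (1 / C) * ennreal C = ennreal (1 / C * C)"
      by (rule ennreal_mult[symmetric]) (use C in simp_all)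
    finally show ?thesis using C by simp
  qed
  then have "\<forall>f \<in> lip_space0 M ?P \<alpha>.
      ennreal (1 / C) * lip_norm0 ?P \<alpha> f \<le> lip_norm ?P \<alpha> k f \<and>
      lip_norm ?P \<alpha> k f \<le> ennreal (2 ^ n) * lip_norm0 ?P \<alpha> f"
    using up unfolding lip_norm0_def lip_space0_def lip_space_def k0_def[symmetric] by auto
  moreover have "0 < 1 / C" "(0::real) < 2 ^ n" using C by auto
  ultimately show ?thesis using spaces by blast
qed

end
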